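(* Let $\mathscr{C}$ be a small category, let $(-\otimes I)$ be elementary homotopy data on the presheaf category $\widehat{\mathscr{C}}$, and let $T$ be a monad on $\widehat{\mathscr{C}}$, with unit $\eta$, satisfying (M1), (M2) and (M3). Let $\mathfrak{W}$ be the class of weak equivalences of the $(\mathfrak{G},I)$-generated model structure. If $\mathfrak{W}'$ is any collection of maps in $\widehat{\mathscr{C}}$ such that (1) $\mathfrak{W}'$ has the 3-for-2 property; (2) $\mathfrak{W}'$ contains all homotopy equivalences; and (3) $\mathfrak{W}'$ contains all units $\eta_X:X\to T(X)$, then $\mathfrak{W}\subseteq\mathfrak{W}'$.
   Context: $\widehat{\mathscr{C}}$ is the category of presheaves of sets on the small category $\mathscr{C}$. Cylinders. A cylinder for a presheaf $X$ is $(X\otimes I,\partial^0,\partial^1,\sigma)$ with maps $\partial^0,\partial^1:X\to X\otimes I$, $\sigma:X\otimes I\to X$ such that $\sigma\partial^0=\sigma\partial^1=1_X$ and $[\partial^0,\partial^1]:X+X\to X\otimes I$ is a monomorphism. A morphism of cylinders $X\otimes I\to Y\otimes I$ is a pair $\phi:X\to Y$, $\psi:X\otimes I\to Y\otimes I$ with $\psi\partial^e=\partial^e\phi$ ($e=0,1$) and $\phi\sigma=\sigma\psi$. A functorial cylinder is a section of the forgetful functor from the category of cylinders to $\widehat{\mathscr{C}}$. Elementary homotopy data is a functorial cylinder $(-\otimes I)$ that commutes with small colimits, preserves monomorphisms, and such that for every monomorphism $j:K\to L$ and $e=0,1$ the square with sides $j:K\to L$, $\partial^e:K\to K\otimes I$,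 $\partial^e:L\to L\otimes I$, $j\otimes I:K\otimes I\to L\otimes I$ is a pullback. Homotopy. A homotopy from $f:X\to Y$ to $g:X\to Y$ is a map $\theta:X\otimes I\to Y$ with $\theta\partial^0=f$, $\theta\partial^1=g$; write $f\simeq g$ if one exists, $\simeq_*$ for the equivalence relation generated by $\simeq$, and $[X,Y]=\widehat{\mathscr{C}}(X,Y)/\simeq_*$. A map $f:X\to Y$ is a homotopy equivalence if there is $g:Y\to X$ with $gf\simeq_* 1_X$ and $fg\simeq_* 1_Y$. Anodyne extensions. For $e=0,1$, $L\otimes\{e\}$ is the image of $\partial^e:L\to L\otimes I$, $L\otimes\partial I$ is the image of $[\partial^0,\partial^1]$, and unions are unions of subobjects of $L\otimes I$. For a set $R$ of monomorphisms put $\mathbf{\Lambda}(R)=\{K\otimes I\cup L\otimes\partial I\to L\otimes I\mid K\to L\in R\}$. A class of maps is saturated if it is closed under pushouts, transfinite compositions and retracts. Fix a set $M$ of monomorphisms whose generated saturated class is the class of all monomorphisms. For a set $S$ of monomorphisms put $\Lambda^0_I(S)=S\cup\{K\otimes I\cup L\otimes\{e\}\to L\otimes I\mid K\to L\in M,\ e=0,1\}$, $\Lambda^{n+1}_I(S)=\mathbf{\Lambda}(\Lambda^n_I(S))$, $\Lambda_I(S)=\bigcup_{n\ge 0}\Lambda^n_I(S)$, and let $\mathfrak{A}_I(S)$ be the class of maps having the left lifting property with respect to all maps that have the right lifting property (RLP) with respect to $\Lambda_I(S)$. The $(S,I)$-generated model structure (which exists by a theorem of Cisinski): cofibrations are the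 monomorphisms; weak equivalences are the maps $f:X\to Y$ such that $[f,A]:[Y,A]\to[X,A]$ is bijective for every $A$ such that $A\to 1$ has the RLP with respect to $\mathfrak{A}_I(S)$ (naively fibrant $A$); fibrations are the maps with the RLP with respect to all maps that are both cofibrations and weak equivalences. Axioms on a monad $T$ on $\widehat{\mathscr{C}}$ with unit $\eta$: (M1) $T$ preserves monomorphisms and every $\eta_X:X\to T(X)$ is a monomorphism. (M2) There is a set of presheaves $(G^j)_{j\in J}$ such that, for every presheaf $X$, $\eta_X:X\to TX$ is in the saturated class generated by the maps $\eta_{G^j}:G^j\to T(G^j)$, $j\in J$. Put $\mathfrak{G}=\{\eta_{G^j}\mid j\in J\}$. (M3) If $A$ is (the underlying presheaf of) a $T$-algebra, then $A\to 1$ has the RLP with respect to the elements of $\mathfrak{A}_I(\mathfrak{G})$. The 3-for-2 property: for composable $f,g$, if two of $f$, $g$, $gf$ are in the class then so is the third. *)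

theory Defs
  imports Main "HOL-Library.FuncSet"
begin

section \<open>Small sets\<close>

text \<open>
  The sets of the theory are the members of a universe \<open>U\<close> of subsets of a type. The axioms hold for
  the family of small sets of a model of set theory and for Grothendieck universes. Closure under
  power sets is not demanded, so that they also hold for \<open>U = UNIV\<close> over any infinite type.
\<close>

locale set_universe =
  fixes U :: "'u set set"
  assumes subset: "\<And>A B. A \<in> U \<Longrightarrow> B \<subseteq> A \<Longrightarrow> B \<in> U"
    and image: "\<And>A (f :: 'u \<Rightarrow> 'u). A \<in> U \<Longrightarrow> f ` A \<in> U"
    and union: "\<And>K (B :: 'u \<Rightarrow> 'u set). K \<in> U \<Longrightarrow> (\<And>k. k \<in> K \<Longrightarrow> B k \<in> U) \<Longrightarrow> (\<Union>k\<in>K. B k) \<in> U"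
    and infinite_set: "\<exists>A\<in>U. infinite A"

definition small :: "'u set set \<Rightarrow> 'x set \<Rightarrow> bool" where
  "small U A \<longleftrightarrow> (\<exists>K\<in>U. \<exists>f. A = f ` K)"


section \<open>Categories\<close>

record ('a, 'b) category =
  Obj :: "'a set"
  Arr :: "'b set"
  src :: "'b \<Rightarrow> 'a"
  tgt :: "'b \<Rightarrow> 'a"
  one :: "'a \<Rightarrow> 'b"
  comp :: "'b \<Rightarrow> 'b \<Rightarrow> 'b" (infixl "\<cdot>\<index>" 70)

definition hom :: "('a, 'b) category \<Rightarrow> 'a \<Rightarrow> 'a \<Rightarrow> 'b set" where
  "hom D X Y = {f \<in> Arr D. src D f = X \<and> tgt D f = Y}"

locale category =
  fixes D :: "('a, 'b) category"
  assumes src_obj: "f \<in> Arr D \<Longrightarrow> src D f \<in> Obj D"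
    and tgt_obj: "f \<in> Arr D \<Longrightarrow> tgt D f \<in> Obj D"
    and one_hom: "X \<in> Obj D \<Longrightarrow> one D X \<in> hom D X X"
    and comp_hom: "f \<in> hom D X Y \<Longrightarrow> g \<in> hom D Y Z \<Longrightarrow> g \<cdot>\<^bsub>D\<^esub> f \<in> hom D X Z"
    and comp_one: "f \<in> hom D X Y \<Longrightarrow> f \<cdot>\<^bsub>D\<^esub> one D X = f"
    and one_comp: "f \<in> hom D X Y \<Longrightarrow> one D Y \<cdot>\<^bsub>D\<^esub> f = f"
    and comp_assoc: "f \<in> hom D W X \<Longrightarrow> g \<in> hom D X Y \<Longrightarrow> h \<in> hom D Y Z \<Longrightarrow>
      h \<cdot>\<^bsub>D\<^esub> (g \<cdot>\<^bsub>D\<^esub> f) = (h \<cdot>\<^bsub>D\<^esub> g) \<cdot>\<^bsub>D\<^esub> f"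

record ('a, 'b, 'c, 'd) func =
  fobj :: "'a \<Rightarrow> 'c"
  farr :: "'b \<Rightarrow> 'd"

definition is_functor ::
    "('a, 'b) category \<Rightarrow> ('c, 'd) category \<Rightarrow> ('a, 'b, 'c, 'd) func \<Rightarrow> bool" where
  "is_functor D E F \<longleftrightarrow>
    (\<forall>X\<in>Obj D. fobj F X \<in> Obj E \<and> farr F (one D X) = one E (fobj F X)) \<and>
    (\<forall>f\<in>Arr D. farr F f \<in> hom E (fobj F (src D f)) (fobj F (tgt D f))) \<and>
    (\<forall>f\<in>Arr D. \<forall>g\<in>Arr D. tgt D f = src D g \<longrightarrow>
      farr F (g \<cdot>\<^bsub>D\<^esub> f) = farr F g \<cdot>\<^bsub>E\<^esub> farr F f)"

definition func_comp ::
    "('c, 'd, 'e, 'f) func \<Rightarrow> ('a, 'b, 'c, 'd) func \<Rightarrow> ('a, 'b, 'e, 'f) func" where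
  "func_comp G F = \<lparr>fobj = fobj G \<circ> fobj F, farr = farr G \<circ> farr F\<rparr>"

definition monic :: "('a, 'b) category \<Rightarrow> 'b \<Rightarrow> bool" where
  "monic D f \<longleftrightarrow> f \<in> Arr D \<and>
    (\<forall>g\<in>Arr D. \<forall>h\<in>Arr D. src D g = src D h \<and> tgt D g = src D f \<and> tgt D h = src D f \<and>
      f \<cdot>\<^bsub>D\<^esub> g = f \<cdot>\<^bsub>D\<^esub> h \<longrightarrow> g = h)"

definition monics :: "('a, 'b) category \<Rightarrow> 'b set" where
  "monics D = {f. monic D f}"

definition preserves_monics :: "('a, 'b) category \<Rightarrow> ('a, 'b, 'a, 'b) func \<Rightarrow> bool" where
  "preserves_monics D F \<longleftrightarrow> (\<forall>f. monic D f \<longrightarrow> monic D (farr F f))"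


subsection \<open>Limits and colimits\<close>

definition is_terminal :: "('a, 'b) category \<Rightarrow> 'a \<Rightarrow> bool" where
  "is_terminal D E \<longleftrightarrow> E \<in> Obj D \<and> (\<forall>X\<in>Obj D. \<exists>!f. f \<in> hom D X E)"

definition to_terminal :: "('a, 'b) category \<Rightarrow> 'a \<Rightarrow> 'b" where
  "to_terminal D A = (THE f. f \<in> hom D A (SOME E. is_terminal D E))"

definition is_coproduct :: "('a, 'b) category \<Rightarrow> 'a \<Rightarrow> 'a \<Rightarrow> 'a \<times> 'b \<times> 'b \<Rightarrow> bool" where
  "is_coproduct D X Y = (\<lambda>(P, i, j).
    i \<in> hom D X P \<and> j \<in> hom D Y P \<and>
    (\<forall>Q. \<forall>f \<in> hom D X Q. \<forall>g \<in> hom D Y Q.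
      \<exists>!u. u \<in> hom D P Q \<and> u \<cdot>\<^bsub>D\<^esub> i = f \<and> u \<cdot>\<^bsub>D\<^esub> j = g))"

text \<open>The map \<open>[f, g] : X + Y \<rightarrow> Q\<close>, for a chosen coproduct \<open>X + Y\<close>.\<close>

definition copair :: "('a, 'b) category \<Rightarrow> 'b \<Rightarrow> 'b \<Rightarrow> 'b" where
  "copair D f g =
    (case SOME c. is_coproduct D (src D f) (src D g) c of
      (P, i, j) \<Rightarrow> THE u. u \<in> hom D P (tgt D f) \<and> u \<cdot>\<^bsub>D\<^esub> i = f \<and> u \<cdot>\<^bsub>D\<^esub> j = g)"

text \<open>In \<open>is_pushout D f g f' g'\<close>, the map \<open>f'\<close> is the pushout of \<open>f\<close> along \<open>g\<close>, and \<open>g' f = f' g\<close>.\<close>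

definition is_pushout :: "('a, 'b) category \<Rightarrow> 'b \<Rightarrow> 'b \<Rightarrow> 'b \<Rightarrow> 'b \<Rightarrow> bool" where
  "is_pushout D f g f' g' \<longleftrightarrow>
    f \<in> Arr D \<and> g \<in> Arr D \<and> f' \<in> Arr D \<and> g' \<in> Arr D \<and>
    src D f = src D g \<and> src D f' = tgt D g \<and> src D g' = tgt D f \<and> tgt D f' = tgt D g' \<and>
    g' \<cdot>\<^bsub>D\<^esub> f = f' \<cdot>\<^bsub>D\<^esub> g \<and>
    (\<forall>Q. \<forall>h \<in> hom D (tgt D f) Q. \<forall>k \<in> hom D (tgt D g) Q. h \<cdot>\<^bsub>D\<^esub> f = k \<cdot>\<^bsub>D\<^esub> g \<longrightarrow>
      (\<exists>!u. u \<in> hom D (tgt D f') Q \<and> u \<cdot>\<^bsub>D\<^esub> g' = h \<and> u \<cdot>\<^bsub>D\<^esub> f' = k))"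

text \<open>In \<open>is_pullback D p q f g\<close>, the maps \<open>p\<close>, \<open>q\<close> are the projections of the pullback of the cospan
  \<open>f\<close>, \<open>g\<close>, and \<open>f p = g q\<close>.\<close>

definition is_pullback :: "('a, 'b) category \<Rightarrow> 'b \<Rightarrow> 'b \<Rightarrow> 'b \<Rightarrow> 'b \<Rightarrow> bool" where
  "is_pullback D p q f g \<longleftrightarrow>
    p \<in> Arr D \<and> q \<in> Arr D \<and> f \<in> Arr D \<and> g \<in> Arr D \<and>
    src D p = src D q \<and> tgt D p = src D f \<and> tgt D q = src D g \<and> tgt D f = tgt D g \<and>
    f \<cdot>\<^bsub>D\<^esub> p = g \<cdot>\<^bsub>D\<^esub> q \<and>
    (\<forall>Q. \<forall>h \<in> hom D Q (src D f). \<forall>k \<in> hom D Q (src D g). f \<cdot>\<^bsub>D\<^esub> h = g \<cdot>\<^bsub>D\<^esub> k \<longrightarrow>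
      (\<exists>!u. u \<in> hom D Q (src D p) \<and> p \<cdot>\<^bsub>D\<^esub> u = h \<and> q \<cdot>\<^bsub>D\<^esub> u = k))"

definition is_cocone :: "('i, 'k) category \<Rightarrow> ('a, 'b) category \<Rightarrow> ('i, 'k, 'a, 'b) func \<Rightarrow>
    'a \<Rightarrow> ('i \<Rightarrow> 'b) \<Rightarrow> bool" where
  "is_cocone J D F V c \<longleftrightarrow> V \<in> Obj D \<and>
    (\<forall>i\<in>Obj J. c i \<in> hom D (fobj F i) V) \<and>
    (\<forall>a\<in>Arr J. c (tgt J a) \<cdot>\<^bsub>D\<^esub> farr F a = c (src J a))"

definition is_colimit :: "('i, 'k) category \<Rightarrow> ('a, 'b) category \<Rightarrow> ('i, 'k, 'a, 'b) func \<Rightarrow>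
    'a \<Rightarrow> ('i \<Rightarrow> 'b) \<Rightarrow> bool" where
  "is_colimit J D F V c \<longleftrightarrow> is_cocone J D F V c \<and>
    (\<forall>W d. is_cocone J D F W d \<longrightarrow>
      (\<exists>!u. u \<in> hom D V W \<and> (\<forall>i\<in>Obj J. u \<cdot>\<^bsub>D\<^esub> c i = d i)))"

text \<open>Up to isomorphism, every small category has its objects and arrows in the type underlying
  the universe.\<close>

definition preserves_small_colimits ::
    "'u set set \<Rightarrow> ('a, 'b) category \<Rightarrow> ('c, 'd) category \<Rightarrow> ('a, 'b, 'c, 'd) func \<Rightarrow> bool" where
  "preserves_small_colimits U D E H \<longleftrightarrow>
    (\<forall>(J :: ('u, 'u) category) F V c.
      category J \<and> small U (Obj J) \<and> small U (Arr J) \<and> is_functor J D F \<and>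
      is_colimit J D F V c \<longrightarrow>
      is_colimit J E (func_comp H F) (fobj H V) (\<lambda>i. farr H (c i)))"


subsection \<open>Lifting properties and saturated classes\<close>

text \<open>\<open>lifts D f p\<close>: \<open>f\<close> has the left lifting property with respect to \<open>p\<close>.\<close>

definition lifts :: "('a, 'b) category \<Rightarrow> 'b \<Rightarrow> 'b \<Rightarrow> bool" where
  "lifts D f p \<longleftrightarrow>
    (\<forall>u \<in> hom D (src D f) (src D p). \<forall>v \<in> hom D (tgt D f) (tgt D p).
      p \<cdot>\<^bsub>D\<^esub> u = v \<cdot>\<^bsub>D\<^esub> f \<longrightarrow>
      (\<exists>l \<in> hom D (tgt D f) (src D p). l \<cdot>\<^bsub>D\<^esub> f = u \<and> p \<cdot>\<^bsub>D\<^esub> l = v))"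

definition LLP :: "('a, 'b) category \<Rightarrow> 'b set \<Rightarrow> 'b set" where
  "LLP D R = {f \<in> Arr D. \<forall>p\<in>R. lifts D f p}"

definition RLP :: "('a, 'b) category \<Rightarrow> 'b set \<Rightarrow> 'b set" where
  "RLP D L = {p \<in> Arr D. \<forall>f\<in>L. lifts D f p}"

text \<open>\<open>f\<close> is a retract of \<open>g\<close> in the category of arrows.\<close>

definition is_retract :: "('a, 'b) category \<Rightarrow> 'b \<Rightarrow> 'b \<Rightarrow> bool" where
  "is_retract D f g \<longleftrightarrow> f \<in> Arr D \<and> g \<in> Arr D \<and>
    (\<exists>i \<in> hom D (src D f) (src D g). \<exists>r \<in> hom D (src D g) (src D f).
     \<exists>i' \<in> hom D (tgt D f) (tgt D g). \<exists>r' \<in> hom D (tgt D g) (tgt D f).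
      r \<cdot>\<^bsub>D\<^esub> i = one D (src D f) \<and> r' \<cdot>\<^bsub>D\<^esub> i' = one D (tgt D f) \<and>
      g \<cdot>\<^bsub>D\<^esub> i = i' \<cdot>\<^bsub>D\<^esub> f \<and> f \<cdot>\<^bsub>D\<^esub> r = r' \<cdot>\<^bsub>D\<^esub> g)"

text \<open>A reflexive order \<open>r\<close> as a category, with an arrow \<open>(i, j)\<close> from \<open>i\<close> to \<open>j\<close> if \<open>(i, j) \<in> r\<close>.\<close>

definition order_cat :: "'i rel \<Rightarrow> ('i, 'i \<times> 'i) category" where
  "order_cat r = \<lparr>Obj = Field r, Arr = r, src = fst, tgt = snd,
    one = (\<lambda>i. (i, i)), comp = (\<lambda>b a. (fst a, snd b))\<rparr>"

definition is_bottom :: "'i rel \<Rightarrow> 'i \<Rightarrow> bool" where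
  "is_bottom r i \<longleftrightarrow> i \<in> Field r \<and> underS r i = {}"

definition is_successor :: "'i rel \<Rightarrow> 'i \<Rightarrow> 'i \<Rightarrow> bool" where
  "is_successor r i j \<longleftrightarrow> (i, j) \<in> r \<and> i \<noteq> j \<and>
    (\<forall>k. (i, k) \<in> r \<and> (k, j) \<in> r \<longrightarrow> k = i \<or> k = j)"

definition is_limit :: "'i rel \<Rightarrow> 'i \<Rightarrow> bool" where
  "is_limit r j \<longleftrightarrow> j \<in> Field r \<and> \<not> is_bottom r j \<and> \<not> (\<exists>i. is_successor r i j)"

text \<open>
  The ordinal \<open>\<lambda> > 0\<close> indexing a transfinite sequence is given by a small well-order \<open>r\<close>. A
  \<open>\<lambda>\<close>-sequence \<open>F\<close> is a functor on \<open>r\<close> that is continuous at the limit stages below \<open>\<lambda>\<close>, and its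
  composite is the map from the initial stage of \<open>F\<close> to the colimit \<open>V\<close> of \<open>F\<close>.
\<close>

definition transfinite_composite ::
    "'u set set \<Rightarrow> ('a, 'b) category \<Rightarrow> 'b set \<Rightarrow> 'b \<Rightarrow> bool" where
  "transfinite_composite U D \<W> f \<longleftrightarrow>
    (\<exists>(r :: 'u rel) F V c b.
      Well_order r \<and> small U (Field r) \<and> is_functor (order_cat r) D F \<and>
      (\<forall>i j. is_successor r i j \<longrightarrow> farr F (i, j) \<in> \<W>) \<and>
      (\<forall>j. is_limit r j \<longrightarrow>
        is_colimit (order_cat (Restr r (underS r j))) D F (fobj F j) (\<lambda>i. farr F (i, j))) \<and>
      is_colimit (order_cat r) D F V c \<and> is_bottom r b \<and> f = c b)"

definition saturated :: "'u set set \<Rightarrow> ('a, 'b) category \<Rightarrow> 'b set \<Rightarrow> bool" where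
  "saturated U D \<W> \<longleftrightarrow> \<W> \<subseteq> Arr D \<and>
    (\<forall>f g f' g'. f \<in> \<W> \<and> is_pushout D f g f' g' \<longrightarrow> f' \<in> \<W>) \<and>
    (\<forall>f. transfinite_composite U D \<W> f \<longrightarrow> f \<in> \<W>) \<and>
    (\<forall>f g. g \<in> \<W> \<and> is_retract D f g \<longrightarrow> f \<in> \<W>)"

definition saturation :: "'u set set \<Rightarrow> ('a, 'b) category \<Rightarrow> 'b set \<Rightarrow> 'b set" where
  "saturation U D S = \<Inter>{\<W>. saturated U D \<W> \<and> S \<subseteq> \<W>}"

definition three_for_two :: "('a, 'b) category \<Rightarrow> 'b set \<Rightarrow> bool" where
  "three_for_two D \<W> \<longleftrightarrow>
    (\<forall>f\<in>Arr D. \<forall>g\<in>Arr D. tgt D f = src D g \<longrightarrow>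
      (f \<in> \<W> \<and> g \<in> \<W> \<longrightarrow> g \<cdot>\<^bsub>D\<^esub> f \<in> \<W>) \<and>
      (f \<in> \<W> \<and> g \<cdot>\<^bsub>D\<^esub> f \<in> \<W> \<longrightarrow> g \<in> \<W>) \<and>
      (g \<in> \<W> \<and> g \<cdot>\<^bsub>D\<^esub> f \<in> \<W> \<longrightarrow> f \<in> \<W>))"


subsection \<open>Monads\<close>

locale monad =
  fixes D :: "('a, 'b) category"
    and T :: "('a, 'b, 'a, 'b) func"
    and \<eta> :: "'a \<Rightarrow> 'b"
    and \<mu> :: "'a \<Rightarrow> 'b"
  assumes endofunctor: "is_functor D D T"
    and unit_hom: "X \<in> Obj D \<Longrightarrow> \<eta> X \<in> hom D X (fobj T X)"
    and mult_hom: "X \<in> Obj D \<Longrightarrow> \<mu> X \<in> hom D (fobj T (fobj T X)) (fobj T X)"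
    and unit_natural: "f \<in> hom D X Y \<Longrightarrow> \<eta> Y \<cdot>\<^bsub>D\<^esub> f = farr T f \<cdot>\<^bsub>D\<^esub> \<eta> X"
    and mult_natural: "f \<in> hom D X Y \<Longrightarrow>
      \<mu> Y \<cdot>\<^bsub>D\<^esub> farr T (farr T f) = farr T f \<cdot>\<^bsub>D\<^esub> \<mu> X"
    and unit_left: "X \<in> Obj D \<Longrightarrow> \<mu> X \<cdot>\<^bsub>D\<^esub> \<eta> (fobj T X) = one D (fobj T X)"
    and unit_right: "X \<in> Obj D \<Longrightarrow> \<mu> X \<cdot>\<^bsub>D\<^esub> farr T (\<eta> X) = one D (fobj T X)"
    and mult_assoc: "X \<in> Obj D \<Longrightarrow>
      \<mu> X \<cdot>\<^bsub>D\<^esub> farr T (\<mu> X) = \<mu> X \<cdot>\<^bsub>D\<^esub> \<mu> (fobj T X)"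

definition is_algebra :: "('a, 'b) category \<Rightarrow> ('a, 'b, 'a, 'b) func \<Rightarrow> ('a \<Rightarrow> 'b) \<Rightarrow> ('a \<Rightarrow> 'b) \<Rightarrow>
    'a \<Rightarrow> 'b \<Rightarrow> bool" where
  "is_algebra D T \<eta> \<mu> A a \<longleftrightarrow> A \<in> Obj D \<and> a \<in> hom D (fobj T A) A \<and>
    a \<cdot>\<^bsub>D\<^esub> \<eta> A = one D A \<and> a \<cdot>\<^bsub>D\<^esub> \<mu> A = a \<cdot>\<^bsub>D\<^esub> farr T a"


section \<open>Cylinders and homotopy\<close>

text \<open>The maps \<open>\<partial>\<^sup>0\<close> and \<open>\<partial>\<^sup>1\<close> are \<open>face False\<close> and \<open>face True\<close>.\<close>

record ('a, 'b) cylinder =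
  base :: 'a
  total :: 'a
  face :: "bool \<Rightarrow> 'b"
  proj :: 'b

definition is_cylinder :: "('a, 'b) category \<Rightarrow> ('a, 'b) cylinder \<Rightarrow> bool" where
  "is_cylinder D Z \<longleftrightarrow> base Z \<in> Obj D \<and> total Z \<in> Obj D \<and>
    (\<forall>e. face Z e \<in> hom D (base Z) (total Z)) \<and> proj Z \<in> hom D (total Z) (base Z) \<and>
    (\<forall>e. proj Z \<cdot>\<^bsub>D\<^esub> face Z e = one D (base Z)) \<and>
    monic D (copair D (face Z False) (face Z True))"

record ('a, 'b) cylinder_map =
  csrc :: "('a, 'b) cylinder"
  ctgt :: "('a, 'b) cylinder"
  on_base :: 'b
  on_total :: 'b

definition is_cylinder_map :: "('a, 'b) category \<Rightarrow> ('a, 'b) cylinder_map \<Rightarrow> bool" where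
  "is_cylinder_map D m \<longleftrightarrow> is_cylinder D (csrc m) \<and> is_cylinder D (ctgt m) \<and>
    on_base m \<in> hom D (base (csrc m)) (base (ctgt m)) \<and>
    on_total m \<in> hom D (total (csrc m)) (total (ctgt m)) \<and>
    (\<forall>e. on_total m \<cdot>\<^bsub>D\<^esub> face (csrc m) e = face (ctgt m) e \<cdot>\<^bsub>D\<^esub> on_base m) \<and>
    on_base m \<cdot>\<^bsub>D\<^esub> proj (csrc m) = proj (ctgt m) \<cdot>\<^bsub>D\<^esub> on_total m"

definition cylinder_cat ::
    "('a, 'b) category \<Rightarrow> (('a, 'b) cylinder, ('a, 'b) cylinder_map) category" where
  "cylinder_cat D = \<lparr>Obj = {Z. is_cylinder D Z}, Arr = {m. is_cylinder_map D m},
    src = csrc, tgt = ctgt,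
    one = (\<lambda>Z. \<lparr>csrc = Z, ctgt = Z, on_base = one D (base Z), on_total = one D (total Z)\<rparr>),
    comp = (\<lambda>n m. \<lparr>csrc = csrc m, ctgt = ctgt n, on_base = on_base n \<cdot>\<^bsub>D\<^esub> on_base m,
      on_total = on_total n \<cdot>\<^bsub>D\<^esub> on_total m\<rparr>)\<rparr>"

type_synonym ('a, 'b) cylinder_func =
  "('a, 'b, ('a, 'b) cylinder, ('a, 'b) cylinder_map) func"

text \<open>A section of the forgetful functor from cylinders to \<open>D\<close>.\<close>

definition functorial_cylinder :: "('a, 'b) category \<Rightarrow> ('a, 'b) cylinder_func \<Rightarrow> bool" where
  "functorial_cylinder D I \<longleftrightarrow> is_functor D (cylinder_cat D) I \<and>
    (\<forall>X\<in>Obj D. base (fobj I X) = X) \<and> (\<forall>f\<in>Arr D. on_base (farr I f) = f)"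

text \<open>The functor \<open>- \<otimes> I\<close>.\<close>

definition tensor :: "('a, 'b) cylinder_func \<Rightarrow> ('a, 'b, 'a, 'b) func" where
  "tensor I = \<lparr>fobj = total \<circ> fobj I, farr = on_total \<circ> farr I\<rparr>"

definition elementary_homotopy_data ::
    "'u set set \<Rightarrow> ('a, 'b) category \<Rightarrow> ('a, 'b) cylinder_func \<Rightarrow> bool" where
  "elementary_homotopy_data U D I \<longleftrightarrow> functorial_cylinder D I \<and>
    preserves_small_colimits U D D (tensor I) \<and> preserves_monics D (tensor I) \<and>
    (\<forall>j e. monic D j \<longrightarrow>
      is_pullback D j (face (fobj I (src D j)) e) (face (fobj I (tgt D j)) e) (farr (tensor I) j))"

definition homotopic ::
    "('a, 'b) category \<Rightarrow> ('a, 'b) cylinder_func \<Rightarrow> 'a \<Rightarrow> 'a \<Rightarrow> 'b rel" where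
  "homotopic D I X Y = {(f, g). f \<in> hom D X Y \<and> g \<in> hom D X Y \<and>
    (\<exists>\<theta> \<in> hom D (fobj (tensor I) X) Y.
      \<theta> \<cdot>\<^bsub>D\<^esub> face (fobj I X) False = f \<and> \<theta> \<cdot>\<^bsub>D\<^esub> face (fobj I X) True = g)}"

text \<open>The equivalence relation on \<open>hom D X Y\<close> generated by homotopy.\<close>

definition homotopic_eq ::
    "('a, 'b) category \<Rightarrow> ('a, 'b) cylinder_func \<Rightarrow> 'a \<Rightarrow> 'a \<Rightarrow> 'b rel" where
  "homotopic_eq D I X Y =
    Restr ((homotopic D I X Y \<union> (homotopic D I X Y)\<inverse>)\<^sup>*) (hom D X Y)"

definition homotopy_classes ::
    "('a, 'b) category \<Rightarrow> ('a, 'b) cylinder_func \<Rightarrow> 'a \<Rightarrow> 'a \<Rightarrow> 'b set set" where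
  "homotopy_classes D I X Y = hom D X Y // homotopic_eq D I X Y"

text \<open>The map \<open>[f, A] : [Y, A] \<rightarrow> [X, A]\<close> for \<open>f : X \<rightarrow> Y\<close>; the class of \<open>g\<close> goes to the class of \<open>g f\<close>.\<close>

definition precomp_class ::
    "('a, 'b) category \<Rightarrow> ('a, 'b) cylinder_func \<Rightarrow> 'b \<Rightarrow> 'a \<Rightarrow> 'b set \<Rightarrow> 'b set" where
  "precomp_class D I f A c = homotopic_eq D I (src D f) A `` ((\<lambda>g. g \<cdot>\<^bsub>D\<^esub> f) ` c)"

definition homotopy_equivalence ::
    "('a, 'b) category \<Rightarrow> ('a, 'b) cylinder_func \<Rightarrow> 'b \<Rightarrow> bool" where
  "homotopy_equivalence D I f \<longleftrightarrow> f \<in> Arr D \<and>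
    (\<exists>g \<in> hom D (tgt D f) (src D f).
      (g \<cdot>\<^bsub>D\<^esub> f, one D (src D f)) \<in> homotopic_eq D I (src D f) (src D f) \<and>
      (f \<cdot>\<^bsub>D\<^esub> g, one D (tgt D f)) \<in> homotopic_eq D I (tgt D f) (tgt D f))"


section \<open>Presheaves\<close>

text \<open>
  Restriction along \<open>a : c \<rightarrow> d\<close> is the function \<open>res X a\<close> from \<open>sec X d\<close> to \<open>sec X c\<close>. All functions
  are extensional, so that equality of presheaves and of their maps is equality of records.
\<close>

record ('o, 'm, 'u) presheaf =
  sec :: "'o \<Rightarrow> 'u set"
  res :: "'m \<Rightarrow> 'u \<Rightarrow> 'u"

definition is_presheaf ::
    "'u set set \<Rightarrow> ('o, 'm) category \<Rightarrow> ('o, 'm, 'u) presheaf \<Rightarrow> bool" where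
  "is_presheaf U C X \<longleftrightarrow>
    sec X \<in> (\<Pi>\<^sub>E c\<in>Obj C. U) \<and>
    res X \<in> (\<Pi>\<^sub>E a\<in>Arr C. sec X (tgt C a) \<rightarrow>\<^sub>E sec X (src C a)) \<and>
    (\<forall>c\<in>Obj C. \<forall>x \<in> sec X c. res X (one C c) x = x) \<and>
    (\<forall>a\<in>Arr C. \<forall>b\<in>Arr C. tgt C a = src C b \<longrightarrow>
      (\<forall>x \<in> sec X (tgt C b). res X (b \<cdot>\<^bsub>C\<^esub> a) x = res X a (res X b x)))"

record ('o, 'm, 'u) presheaf_map =
  msrc :: "('o, 'm, 'u) presheaf"
  mtgt :: "('o, 'm, 'u) presheaf"
  app :: "'o \<Rightarrow> 'u \<Rightarrow> 'u"

definition is_presheaf_map ::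
    "'u set set \<Rightarrow> ('o, 'm) category \<Rightarrow> ('o, 'm, 'u) presheaf_map \<Rightarrow> bool" where
  "is_presheaf_map U C f \<longleftrightarrow> is_presheaf U C (msrc f) \<and> is_presheaf U C (mtgt f) \<and>
    app f \<in> (\<Pi>\<^sub>E c\<in>Obj C. sec (msrc f) c \<rightarrow>\<^sub>E sec (mtgt f) c) \<and>
    (\<forall>a\<in>Arr C. \<forall>x \<in> sec (msrc f) (tgt C a).
      app f (src C a) (res (msrc f) a x) = res (mtgt f) a (app f (tgt C a) x))"

definition PSh :: "'u set set \<Rightarrow> ('o, 'm) category \<Rightarrow>
    (('o, 'm, 'u) presheaf, ('o, 'm, 'u) presheaf_map) category" where
  "PSh U C = \<lparr>Obj = {X. is_presheaf U C X}, Arr = {f. is_presheaf_map U C f},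
    src = msrc, tgt = mtgt,
    one = (\<lambda>X. \<lparr>msrc = X, mtgt = X, app = (\<lambda>c\<in>Obj C. \<lambda>x\<in>sec X c. x)\<rparr>),
    comp = (\<lambda>g f. \<lparr>msrc = msrc f, mtgt = mtgt g,
      app = (\<lambda>c\<in>Obj C. \<lambda>x\<in>sec (msrc f) c. app g c (app f c x))\<rparr>)\<rparr>"

text \<open>Subobjects of a presheaf are represented by families of sets of sections.\<close>

definition map_image :: "('o, 'm, 'u) presheaf_map \<Rightarrow> 'o \<Rightarrow> 'u set" where
  "map_image f = (\<lambda>c. app f c ` sec (msrc f) c)"

definition subpresheaf ::
    "('o, 'm) category \<Rightarrow> ('o, 'm, 'u) presheaf \<Rightarrow> ('o \<Rightarrow> 'u set) \<Rightarrow> ('o, 'm, 'u) presheaf" where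
  "subpresheaf C X A = \<lparr>sec = (\<lambda>c\<in>Obj C. A c), res = (\<lambda>a\<in>Arr C. \<lambda>x\<in>A (tgt C a). res X a x)\<rparr>"

definition inclusion ::
    "('o, 'm) category \<Rightarrow> ('o, 'm, 'u) presheaf \<Rightarrow> ('o \<Rightarrow> 'u set) \<Rightarrow> ('o, 'm, 'u) presheaf_map" where
  "inclusion C X A =
    \<lparr>msrc = subpresheaf C X A, mtgt = X, app = (\<lambda>c\<in>Obj C. \<lambda>x\<in>A c. x)\<rparr>"


section \<open>Anodyne extensions and the generated model structure\<close>

type_synonym ('o, 'm, 'u) presheaf_cylinder =
  "(('o, 'm, 'u) presheaf, ('o, 'm, 'u) presheaf_map) cylinder_func"

text \<open>The subobjects \<open>L \<otimes> {e}\<close> and \<open>L \<otimes> \<partial>I\<close> of \<open>L \<otimes> I\<close>.\<close>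

definition end_part :: "('o, 'm, 'u) presheaf_cylinder \<Rightarrow> ('o, 'm, 'u) presheaf \<Rightarrow> bool \<Rightarrow>
    'o \<Rightarrow> 'u set" where
  "end_part I L e = map_image (face (fobj I L) e)"

definition boundary_part :: "'u set set \<Rightarrow> ('o, 'm) category \<Rightarrow> ('o, 'm, 'u) presheaf_cylinder \<Rightarrow>
    ('o, 'm, 'u) presheaf \<Rightarrow> 'o \<Rightarrow> 'u set" where
  "boundary_part U C I L =
    map_image (copair (PSh U C) (face (fobj I L) False) (face (fobj I L) True))"

text \<open>The inclusion \<open>K \<otimes> I \<union> B \<rightarrow> L \<otimes> I\<close> for a monomorphism \<open>j : K \<rightarrow> L\<close> and a subobject \<open>B\<close> of
  \<open>L \<otimes> I\<close>; here \<open>K \<otimes> I\<close> is the subobject given by the monomorphism \<open>j \<otimes> I\<close>.\<close>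

definition union_inclusion :: "('o, 'm) category \<Rightarrow> ('o, 'm, 'u) presheaf_cylinder \<Rightarrow>
    ('o, 'm, 'u) presheaf_map \<Rightarrow> ('o \<Rightarrow> 'u set) \<Rightarrow> ('o, 'm, 'u) presheaf_map" where
  "union_inclusion C I j B =
    inclusion C (fobj (tensor I) (mtgt j)) (\<lambda>c. map_image (farr (tensor I) j) c \<union> B c)"

definition Lambda :: "'u set set \<Rightarrow> ('o, 'm) category \<Rightarrow> ('o, 'm, 'u) presheaf_cylinder \<Rightarrow>
    ('o, 'm, 'u) presheaf_map set \<Rightarrow> ('o, 'm, 'u) presheaf_map set" where
  "Lambda U C I R = {union_inclusion C I j (boundary_part U C I (mtgt j)) | j. j \<in> R}"

primrec Lambda_stage :: "'u set set \<Rightarrow> ('o, 'm) category \<Rightarrow> ('o, 'm, 'u) presheaf_cylinder \<Rightarrow>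
    ('o, 'm, 'u) presheaf_map set \<Rightarrow> ('o, 'm, 'u) presheaf_map set \<Rightarrow> nat \<Rightarrow>
    ('o, 'm, 'u) presheaf_map set" where
  "Lambda_stage U C I M S 0 =
    S \<union> {union_inclusion C I j (end_part I (mtgt j) e) | j e. j \<in> M}"
| "Lambda_stage U C I M S (Suc n) = Lambda U C I (Lambda_stage U C I M S n)"

text \<open>The class \<open>\<AA>\<^sub>I(S)\<close>, where the set \<open>M\<close> generates the monomorphisms.\<close>

definition anodyne :: "'u set set \<Rightarrow> ('o, 'm) category \<Rightarrow> ('o, 'm, 'u) presheaf_cylinder \<Rightarrow>
    ('o, 'm, 'u) presheaf_map set \<Rightarrow> ('o, 'm, 'u) presheaf_map set \<Rightarrow>
    ('o, 'm, 'u) presheaf_map set" where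
  "anodyne U C I M S =
    LLP (PSh U C) (RLP (PSh U C) (\<Union>n. Lambda_stage U C I M S n))"

definition naively_fibrant :: "'u set set \<Rightarrow> ('o, 'm) category \<Rightarrow>
    ('o, 'm, 'u) presheaf_cylinder \<Rightarrow> ('o, 'm, 'u) presheaf_map set \<Rightarrow>
    ('o, 'm, 'u) presheaf_map set \<Rightarrow> ('o, 'm, 'u) presheaf \<Rightarrow> bool" where
  "naively_fibrant U C I M S A \<longleftrightarrow> A \<in> Obj (PSh U C) \<and>
    to_terminal (PSh U C) A \<in> RLP (PSh U C) (anodyne U C I M S)"

definition gen_weak_equivalences :: "'u set set \<Rightarrow> ('o, 'm) category \<Rightarrow>
    ('o, 'm, 'u) presheaf_cylinder \<Rightarrow> ('o, 'm, 'u) presheaf_map set \<Rightarrow>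
    ('o, 'm, 'u) presheaf_map set \<Rightarrow> ('o, 'm, 'u) presheaf_map set" where
  "gen_weak_equivalences U C I M S = {f \<in> Arr (PSh U C).
    \<forall>A. naively_fibrant U C I M S A \<longrightarrow>
      bij_betw (precomp_class (PSh U C) I f A)
        (homotopy_classes (PSh U C) I (mtgt f) A) (homotopy_classes (PSh U C) I (msrc f) A)}"

record 'b model_structure =
  cofibrations :: "'b set"
  weak_equivalences :: "'b set"
  fibrations :: "'b set"

definition generated_model_structure :: "'u set set \<Rightarrow> ('o, 'm) category \<Rightarrow>
    ('o, 'm, 'u) presheaf_cylinder \<Rightarrow> ('o, 'm, 'u) presheaf_map set \<Rightarrow>
    ('o, 'm, 'u) presheaf_map set \<Rightarrow> ('o, 'm, 'u) presheaf_map model_structure" where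
  "generated_model_structure U C I M S =
    \<lparr>cofibrations = monics (PSh U C),
     weak_equivalences = gen_weak_equivalences U C I M S,
     fibrations = RLP (PSh U C) (monics (PSh U C) \<inter> gen_weak_equivalences U C I M S)\<rparr>"

end

theory Submission imports Defs begin

text \<open>
  Let \<open>A\<close> be naively fibrant. The maps \<open>j : K \<rightarrow> L\<close> along which all maps into \<open>A\<close>, and all homotopies
  into \<open>A\<close> with prescribed ends on \<open>L\<close>, extend form a saturated class, because \<open>- \<otimes> I\<close> preserves
  colimits. This class contains \<open>\<GG>\<close>, because \<open>\<GG>\<close> and \<open>\<^bold>\<Lambda>(\<GG>)\<close> consist of anodyne extensions, and
  hence it contains all units by (M2); so \<open>[\<eta>\<^sub>X, A]\<close> is bijective. If \<open>f : X \<rightarrow> Y\<close> is a weak equivalence,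
  then by naturality of \<open>\<eta>\<close> also \<open>[T f, A]\<close> is bijective for all such \<open>A\<close>. Free algebras are naively
  fibrant by (M3), so \<open>T f\<close> is a homotopy equivalence by the Yoneda argument. Then \<open>T f\<close> and the units
  lie in \<open>\<W>'\<close>, and \<open>\<eta>\<^sub>Y f = T f \<eta>\<^sub>X\<close> gives \<open>f \<in> \<W>'\<close>.
\<close>

section \<open>Extension problems and saturated classes\<close>

text \<open>Bijectivity of [j, A] does not visibly pass to pushouts and transfinite composites,
  whereas strict extension of maps and of homotopies does; that is why saturation is argued for
  extensions. Fixing the ends on all of L beforehand is what makes this work: on a colimit the end
  maps are already given and restrict to every stage, so only the homotopy has to be built from its
  stages. Injectivity needs both kinds of extension: the relation on maps is generated by
  homotopies, so a chain of homotopies on K passes through maps K -> A that need not come from L.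
  Each of these is extended to L, and then the homotopies are extended link by link. In the Yoneda
  argument surjectivity is tested at T X and injectivity at T Y, both free algebras. A technical
  obstacle is that preservation of colimits is given for shapes with objects and arrows in the type
  of the universe, and that sections live there as well; so diagrams, pairs and disjoint unions are
  coded in that type.\<close>

lemma (in set_universe) small_iff: "small U A \<longleftrightarrow> A \<in> U" for A :: "'u set"
  unfolding small_def using image by (metis image_ident)

text \<open>An infinite type is equinumerous with its square. The injection serves to code in
  \<open>'u\<close> the arrows of an order and the sections of fibre products and
  coproducts.\<close>

lemma (in set_universe) pairing: "\<exists>p :: 'u \<times> 'u \<Rightarrow> 'u. inj p"
proof -
  have "infinite (UNIV :: 'u set)"
    using infinite_set infinite_super[OF subset_UNIV] by blast
  then have "(card_of (UNIV \<times> UNIV :: ('u \<times> 'u) set), card_of (UNIV :: 'u set)) \<in> ordIso"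
    by (rule card_of_Times_same_infinite)
  then obtain p :: "'u \<times> 'u \<Rightarrow> 'u" where "bij_betw p (UNIV \<times> UNIV) UNIV"
    using card_of_ordIso by blast
  then show ?thesis
    by (auto simp: bij_betw_def)
qed

text \<open>The coded product is a union, indexed by \<open>A\<close>, of images of
  \<open>B\<close>.\<close>

lemma (in set_universe) image_Times:
  fixes p :: "'u \<times> 'u \<Rightarrow> 'u"
  assumes "A \<in> U" "B \<in> U"
  shows "p ` (A \<times> B) \<in> U"
proof -
  have "(\<Union>a\<in>A. (\<lambda>b. p (a, b)) ` B) \<in> U"
    using assms by (intro union image) auto
  also have "(\<Union>a\<in>A. (\<lambda>b. p (a, b)) ` B) = p ` (A \<times> B)"
    by auto
  finally show ?thesis .
qed

text \<open>An infinite member of \<open>U\<close> has subsets of every finite cardinality, and one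
  of them maps onto \<open>A\<close>.\<close>

lemma (in set_universe) finite_mem:
  fixes A :: "'u set"
  assumes "finite A"
  shows "A \<in> U"
proof -
  obtain B where B: "B \<in> U" "infinite B"
    using infinite_set by blast
  then obtain C where C: "C \<subseteq> B" "finite C" "card C = card A"
    using infinite_arbitrarily_large by metis
  then obtain f where "bij_betw f C A"
    using assms finite_same_card_bij by metis
  then show ?thesis
    using subset[OF B(1) C(1)] image[of C f] by (simp add: bij_betw_def)
qed

section \<open>Hom sets, functors and colimits indexed by preorders\<close>

lemma homD:
  "f \<in> hom D X Y \<Longrightarrow> f \<in> Arr D"
  "f \<in> hom D X Y \<Longrightarrow> src D f = X"
  "f \<in> hom D X Y \<Longrightarrow> tgt D f = Y"
  by (auto simp: hom_def)

lemma Arr_hom: "f \<in> Arr D \<Longrightarrow> f \<in> hom D (src D f) (tgt D f)"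
  by (simp add: hom_def)

lemma functor_hom:
  "is_functor D E F \<Longrightarrow> f \<in> hom D X Y \<Longrightarrow> farr F f \<in> hom E (fobj F X) (fobj F Y)"
  by (auto simp: is_functor_def hom_def)

lemma functor_one: "is_functor D E F \<Longrightarrow> X \<in> Obj D \<Longrightarrow> farr F (one D X) = one E (fobj F X)"
  by (simp add: is_functor_def)

lemma functor_comp:
  "is_functor D E F \<Longrightarrow> f \<in> hom D X Y \<Longrightarrow> g \<in> hom D Y Z \<Longrightarrow>
    farr F (g \<cdot>\<^bsub>D\<^esub> f) = farr F g \<cdot>\<^bsub>E\<^esub> farr F f"
  by (auto simp: is_functor_def hom_def)

text \<open>Spans and well-orders are both preorders, so this class of shapes serves pushouts and
  transfinite composites alike. The arrows of \<open>order_cat r\<close> are pairs, not elements of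
  \<open>'u\<close>, so these shapes are not literally among those of
  \<open>preserves_small_colimits\<close>.\<close>

definition preserves_order_colimits ::
    "'u set set \<Rightarrow> ('a, 'b) category \<Rightarrow> ('a, 'b, 'a, 'b) func \<Rightarrow> bool" where
  "preserves_order_colimits U D H \<longleftrightarrow>
    (\<forall>(r :: 'u rel) F V c.
      Preorder r \<and> Field r \<in> U \<and> is_functor (order_cat r) D F \<and> is_colimit (order_cat r) D F V c \<longrightarrow>
      is_colimit (order_cat r) D (func_comp H F) (fobj H V) (\<lambda>i. farr H (c i)))"

lemma Preorder_closed:
  "Preorder r \<Longrightarrow> i \<in> Field r \<Longrightarrow> (i, i) \<in> r"
  "Preorder r \<Longrightarrow> (i, j) \<in> r \<Longrightarrow> (j, k) \<in> r \<Longrightarrow> (i, k) \<in> r"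
  by (auto simp: preorder_on_def refl_on_def trans_def)

context set_universe begin

text \<open>Renaming the arrows of \<open>order_cat r\<close> along an injection \<open>p\<close>
  gives a category \<open>J\<close> with arrows in \<open>'u\<close>. It has the same objects and
  the same cocones, hence the same colimits, and its set of arrows is small as part of a coded
  product.\<close>

lemma preserves_order_colimits:
  assumes H: "preserves_small_colimits U D D H"
  shows "preserves_order_colimits U D H"
  unfolding preserves_order_colimits_def
proof (intro allI impI, elim conjE)
  fix r :: "'u rel" and F V c
  assume r: "Preorder r" and small: "Field r \<in> U" and F: "is_functor (order_cat r) D F"
    and V: "is_colimit (order_cat r) D F V c"
  obtain p :: "'u \<times> 'u \<Rightarrow> 'u" where p: "inj p"
    using pairing by blast
  define q where "q = inv p"
  have qp [simp]: "q (p z) = z" for z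
    using p by (simp add: q_def)
  define J :: "('u, 'u) category" where "J = \<lparr>Obj = Field r, Arr = p ` r, src = fst \<circ> q, tgt = snd \<circ> q,
    one = (\<lambda>i. p (i, i)), comp = (\<lambda>b a. p (fst (q a), snd (q b)))\<rparr>"
  define F' where "F' = \<lparr>fobj = fobj F, farr = farr F \<circ> q\<rparr>"
  note [simp] = Preorder_closed(1)[OF r]
  note trans = Preorder_closed(2)[OF r]
  have Obj: "Obj J = Obj (order_cat r)"
    by (simp add: J_def order_cat_def)
  have J: "category J"
    by unfold_locales (auto simp: J_def hom_def FieldI1 FieldI2 intro!: imageI intro: trans)
  have F': "is_functor J D F'"
    using F by (auto simp: is_functor_def J_def F'_def order_cat_def)
  have cocone: "is_cocone J D F' W d \<longleftrightarrow> is_cocone (order_cat r) D F W d" for W d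
    by (auto simp: is_cocone_def J_def F'_def order_cat_def)
  have cocone_H: "is_cocone J D (func_comp H F') W d \<longleftrightarrow> is_cocone (order_cat r) D (func_comp H F) W d"
    for W d by (auto simp: is_cocone_def J_def F'_def order_cat_def func_comp_def)
  have "p ` r \<in> U"
    by (rule subset[OF image_Times[OF small small, of p]]) (auto intro: FieldI1 FieldI2)
  then have "small U (Obj J)" "small U (Arr J)"
    using small by (simp_all add: small_iff J_def)
  moreover have "is_colimit J D F' V c"
    using V unfolding is_colimit_def cocone Obj .
  ultimately have "is_colimit J D (func_comp H F') (fobj H V) (\<lambda>i. farr H (c i))"
    using H J F' unfolding preserves_small_colimits_def by blast
  then show "is_colimit (order_cat r) D (func_comp H F) (fobj H V) (\<lambda>i. farr H (c i))"
    unfolding is_colimit_def cocone_H Obj .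
qed

end

lemma func_comp_id: "func_comp \<lparr>fobj = id, farr = id\<rparr> F = F"
  by (cases F) (simp add: func_comp_def)

lemma preserves_order_colimits_id: "preserves_order_colimits U D \<lparr>fobj = id, farr = id\<rparr>"
  by (simp add: preserves_order_colimits_def func_comp_id)

text \<open>
  \<open>d k\<close>, for \<open>k \<in> N\<close>, are natural transformations from the identity to \<open>H\<close>. With \<open>H\<close> the identity and \<open>N\<close>
  empty this is the extension of maps into \<open>A\<close> along \<open>j\<close>; with \<open>H = - \<otimes> I\<close> and the two end maps it is the
  extension of homotopies with prescribed ends.
\<close>

definition extends_along :: "('a, 'b) category \<Rightarrow> ('a, 'b, 'a, 'b) func \<Rightarrow>
    'k set \<Rightarrow> ('k \<Rightarrow> 'a \<Rightarrow> 'b) \<Rightarrow> 'a \<Rightarrow> 'b \<Rightarrow> bool" where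
  "extends_along D H N d A j \<longleftrightarrow> j \<in> Arr D \<and>
    (\<forall>\<theta> \<in> hom D (fobj H (src D j)) A. \<forall>g.
      (\<forall>k\<in>N. g k \<in> hom D (tgt D j) A \<and> g k \<cdot>\<^bsub>D\<^esub> j = \<theta> \<cdot>\<^bsub>D\<^esub> d k (src D j)) \<longrightarrow>
      (\<exists>\<Theta> \<in> hom D (fobj H (tgt D j)) A. \<Theta> \<cdot>\<^bsub>D\<^esub> farr H j = \<theta> \<and>
        (\<forall>k\<in>N. \<Theta> \<cdot>\<^bsub>D\<^esub> d k (tgt D j) = g k)))"

lemma extends_alongE:
  assumes "extends_along D H N d A j" "j \<in> hom D K L" "\<theta> \<in> hom D (fobj H K) A"
    "\<And>k. k \<in> N \<Longrightarrow> g k \<in> hom D L A" "\<And>k. k \<in> N \<Longrightarrow> g k \<cdot>\<^bsub>D\<^esub> j = \<theta> \<cdot>\<^bsub>D\<^esub> d k K"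
  obtains \<Theta> where "\<Theta> \<in> hom D (fobj H L) A" "\<Theta> \<cdot>\<^bsub>D\<^esub> farr H j = \<theta>" "\<And>k. k \<in> N \<Longrightarrow> \<Theta> \<cdot>\<^bsub>D\<^esub> d k L = g k"
proof -
  have "\<exists>\<Theta> \<in> hom D (fobj H L) A. \<Theta> \<cdot>\<^bsub>D\<^esub> farr H j = \<theta> \<and> (\<forall>k\<in>N. \<Theta> \<cdot>\<^bsub>D\<^esub> d k L = g k)"
    using assms(1-5) unfolding extends_along_def by (simp add: homD)
  then show ?thesis using that by blast
qed

lemma extends_alongI:
  assumes "j \<in> hom D K L"
    and "\<And>\<theta> g. \<theta> \<in> hom D (fobj H K) A \<Longrightarrow> (\<And>k. k \<in> N \<Longrightarrow> g k \<in> hom D L A) \<Longrightarrow>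
      (\<And>k. k \<in> N \<Longrightarrow> g k \<cdot>\<^bsub>D\<^esub> j = \<theta> \<cdot>\<^bsub>D\<^esub> d k K) \<Longrightarrow>
      \<exists>\<Theta> \<in> hom D (fobj H L) A. \<Theta> \<cdot>\<^bsub>D\<^esub> farr H j = \<theta> \<and> (\<forall>k\<in>N. \<Theta> \<cdot>\<^bsub>D\<^esub> d k L = g k)"
  shows "extends_along D H N d A j"
  using assms unfolding extends_along_def by (auto simp: homD)

lemma colimit_map_unique:
  assumes "is_colimit J D F V c" "is_cocone J D F W d"
    "u \<in> hom D V W" "v \<in> hom D V W"
    "\<And>i. i \<in> Obj J \<Longrightarrow> u \<cdot>\<^bsub>D\<^esub> c i = d i" "\<And>i. i \<in> Obj J \<Longrightarrow> v \<cdot>\<^bsub>D\<^esub> c i = d i"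
  shows "u = v"
  using assms unfolding is_colimit_def by blast

lemma colimit_map_ex:
  assumes "is_colimit J D F V c" "is_cocone J D F W d"
  obtains u where "u \<in> hom D V W" "\<And>i. i \<in> Obj J \<Longrightarrow> u \<cdot>\<^bsub>D\<^esub> c i = d i"
  using assms unfolding is_colimit_def by blast

lemma (in category) hom_Obj:
  "f \<in> hom D X Y \<Longrightarrow> X \<in> Obj D" "f \<in> hom D X Y \<Longrightarrow> Y \<in> Obj D"
  using src_obj tgt_obj by (auto simp: hom_def)

lemma (in category) is_cocone_comp:
  assumes "is_cocone J D F V c" "w \<in> hom D V W" "is_functor J D F"
    "\<And>a. a \<in> Arr J \<Longrightarrow> src J a \<in> Obj J \<and> tgt J a \<in> Obj J"
  shows "is_cocone J D F W (\<lambda>i. w \<cdot>\<^bsub>D\<^esub> c i)"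
  unfolding is_cocone_def
proof (intro conjI ballI)
  show "W \<in> Obj D" using assms(2) hom_Obj by blast
  show "w \<cdot>\<^bsub>D\<^esub> c i \<in> hom D (fobj F i) W" if "i \<in> Obj J" for i
    using assms that comp_hom unfolding is_cocone_def by blast
  show "(w \<cdot>\<^bsub>D\<^esub> c (tgt J a)) \<cdot>\<^bsub>D\<^esub> farr F a = w \<cdot>\<^bsub>D\<^esub> c (src J a)" if "a \<in> Arr J" for a
    using assms that comp_assoc[of "farr F a" "fobj F (src J a)" "fobj F (tgt J a)" "c (tgt J a)" V w W]
    unfolding is_cocone_def is_functor_def by auto
qed

lemma functor_id: "is_functor D D \<lparr>fobj = id, farr = id\<rparr>" if "category D"
proof -
  interpret category D by fact
  show ?thesis using one_hom by (auto simp: is_functor_def hom_def)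
qed

section \<open>Closure of extension problems under pushouts, retracts and transfinite
  composition\<close>

locale extension_problem = set_universe U + category D
  for U :: "'u set set" and D :: "('a, 'b) category" +
  fixes H :: "('a, 'b, 'a, 'b) func" and N :: "'k set" and d :: "'k \<Rightarrow> 'a \<Rightarrow> 'b" and A :: 'a
  assumes H_functor: "is_functor D D H"
    and d_hom: "k \<in> N \<Longrightarrow> X \<in> Obj D \<Longrightarrow> d k X \<in> hom D X (fobj H X)"
    and d_natural: "k \<in> N \<Longrightarrow> f \<in> hom D X Y \<Longrightarrow> d k Y \<cdot>\<^bsub>D\<^esub> f = farr H f \<cdot>\<^bsub>D\<^esub> d k X"
    and colimits: "preserves_order_colimits U D H"
begin

text \<open>Compatible solutions \<open>x i\<close> on the stages form a cocone under the
  \<open>H\<close>-image of the diagram, whose colimit is \<open>H\<close> of \<open>V\<close>. That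
  \<open>y\<close> has the prescribed restrictions \<open>w k\<close> is an equation of maps out of
  \<open>V\<close> itself, so it is checked on the legs \<open>c i\<close>, where naturality of
  \<open>d\<close> reduces it to \<open>xw\<close>.\<close>

lemma colimit_extension:
  fixes r :: "'u rel"
  assumes r: "Preorder r" "Field r \<in> U" and F: "is_functor (order_cat r) D F"
    and V: "is_colimit (order_cat r) D F V c"
    and x: "\<And>i. i \<in> Field r \<Longrightarrow> x i \<in> hom D (fobj H (fobj F i)) A"
    and compatible: "\<And>i j. (i, j) \<in> r \<Longrightarrow> x j \<cdot>\<^bsub>D\<^esub> farr H (farr F (i, j)) = x i"
    and w: "\<And>k. k \<in> N \<Longrightarrow> w k \<in> hom D V A"
    and xw: "\<And>i k. i \<in> Field r \<Longrightarrow> k \<in> N \<Longrightarrow> x i \<cdot>\<^bsub>D\<^esub> d k (fobj F i) = w k \<cdot>\<^bsub>D\<^esub> c i"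
    and A: "A \<in> Obj D"
  obtains y where "y \<in> hom D (fobj H V) A" "\<And>k. k \<in> N \<Longrightarrow> y \<cdot>\<^bsub>D\<^esub> d k V = w k"
    "\<And>i. i \<in> Field r \<Longrightarrow> y \<cdot>\<^bsub>D\<^esub> farr H (c i) = x i"
proof -
  have HV: "is_colimit (order_cat r) D (func_comp H F) (fobj H V) (\<lambda>i. farr H (c i))"
    using colimits r F V unfolding preserves_order_colimits_def by blast
  have "is_cocone (order_cat r) D (func_comp H F) A x"
    using x compatible A by (auto simp: is_cocone_def order_cat_def func_comp_def)
  from colimit_map_ex[OF HV this] obtain y where y: "y \<in> hom D (fobj H V) A"
    and yx: "\<And>i. i \<in> Field r \<Longrightarrow> y \<cdot>\<^bsub>D\<^esub> farr H (c i) = x i"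
    by (auto simp: order_cat_def)
  have cocone: "is_cocone (order_cat r) D F V c" and Obj: "V \<in> Obj D"
    using V by (auto simp: is_colimit_def is_cocone_def)
  have "y \<cdot>\<^bsub>D\<^esub> d k V = w k" if k: "k \<in> N" for k
  proof (rule colimit_map_unique[OF V])
    show "is_cocone (order_cat r) D F A (\<lambda>i. w k \<cdot>\<^bsub>D\<^esub> c i)"
      by (rule is_cocone_comp[OF cocone w[OF k] F]) (auto simp: order_cat_def FieldI1 FieldI2)
    show "y \<cdot>\<^bsub>D\<^esub> d k V \<in> hom D V A"
      using comp_hom[OF d_hom[OF k Obj] y] .
    fix i assume "i \<in> Obj (order_cat r)"
    then have i: "i \<in> Field r" by (simp add: order_cat_def)
    have ci: "c i \<in> hom D (fobj F i) V"
      using cocone i by (simp add: is_cocone_def order_cat_def)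
    show "y \<cdot>\<^bsub>D\<^esub> d k V \<cdot>\<^bsub>D\<^esub> c i = w k \<cdot>\<^bsub>D\<^esub> c i"
      using comp_assoc[OF ci d_hom[OF k Obj] y] d_natural[OF k ci] yx[OF i] xw[OF i k]
        comp_assoc[OF d_hom[OF k hom_Obj(1)[OF ci]] functor_hom[OF H_functor ci] y] by metis
  qed (use w[OF k] in auto)
  then show ?thesis using that y yx by blast
qed

text \<open>Restrict the problem for \<open>f'\<close> along \<open>g\<close> and \<open>g'\<close>
  to one for \<open>f\<close>, solve it, and glue the solution with \<open>\<theta>\<close>. The
  pushout enters as a colimit over a three-element preorder, the form in which \<open>H\<close> is
  known to preserve it.\<close>

lemma extends_along_pushout:
  assumes f: "extends_along D H N d A f" and po: "is_pushout D f g f' g'"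
  shows "extends_along D H N d A f'"
proof -
  define K L K' L' where "K = src D f" and "L = tgt D f" and "K' = tgt D g" and "L' = tgt D f'"
  note defs = this
  have homs: "f \<in> hom D K L" "g \<in> hom D K K'" "f' \<in> hom D K' L'" "g' \<in> hom D L L'"
    and square: "g' \<cdot>\<^bsub>D\<^esub> f = f' \<cdot>\<^bsub>D\<^esub> g"
    using po by (auto simp: is_pushout_def defs hom_def)
  have univ: "\<exists>!u. u \<in> hom D L' Q \<and> u \<cdot>\<^bsub>D\<^esub> g' = h \<and> u \<cdot>\<^bsub>D\<^esub> f' = k"
    if "h \<in> hom D L Q" "k \<in> hom D K' Q" "h \<cdot>\<^bsub>D\<^esub> f = k \<cdot>\<^bsub>D\<^esub> g" for Q h k
    using po that unfolding is_pushout_def defs by blast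
  \<comment> \<open>Names in \<open>'u\<close> for the corners of the span are taken from three
    distinct elements: \<open>o0\<close> is the apex \<open>K\<close>, and above it lie
    \<open>o1\<close> for \<open>L\<close> and \<open>o2\<close> for \<open>K'\<close>.\<close>
  obtain S :: "'u set" where "card S = 3" "finite S"
    using infinite_set infinite_arbitrarily_large by metis
  then obtain o0 o1 o2 :: 'u where [simp]: "o0 \<noteq> o1" "o1 \<noteq> o2" "o0 \<noteq> o2"
    by (metis card_3_iff)
  have [simp]: "o1 \<noteq> o0" "o2 \<noteq> o1" "o2 \<noteq> o0"
    using \<open>o0 \<noteq> o1\<close> \<open>o1 \<noteq> o2\<close> \<open>o0 \<noteq> o2\<close> by blast+
  define r where "r = {(o0, o0), (o1, o1), (o2, o2), (o0, o1), (o0, o2)}"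
  define F where "F = \<lparr>fobj = (\<lambda>i. if i = o0 then K else if i = o1 then L else K'),
    farr = (\<lambda>(i, j). if j = o0 then one D K
      else if j = o1 then (if i = o0 then f else one D L) else (if i = o0 then g else one D K'))\<rparr>"
  define c where "c i = (if i = o0 then g' \<cdot>\<^bsub>D\<^esub> f else if i = o1 then g' else f')" for i
  have Field: "Field r = {o0, o1, o2}"
    by (auto simp: r_def Field_def)
  have r: "Preorder r"
    unfolding preorder_on_def refl_on_def trans_def Field by (auto simp: r_def)
  have Fr: "Field r \<in> U"
    by (simp add: Field finite_mem)
  note objs = hom_Obj[OF homs(1)] hom_Obj[OF homs(2)] hom_Obj[OF homs(3)]
  note ones = one_hom[OF objs(1)] one_hom[OF objs(2)] one_hom[OF objs(4)]
  have F: "is_functor (order_cat r) D F"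
    unfolding is_functor_def order_cat_def category.simps Field
    using ones homs objs by (auto simp: r_def F_def comp_one one_comp)
  have V: "is_colimit (order_cat r) D F L' c"
    unfolding is_colimit_def
  proof (intro conjI allI impI)
    show "is_cocone (order_cat r) D F L' c"
      unfolding is_cocone_def order_cat_def category.simps Field
      using homs objs square comp_hom[OF homs(1,4)]
      by (auto simp: r_def F_def c_def comp_one)
    fix W e assume e: "is_cocone (order_cat r) D F W e"
    then have e': "e o1 \<in> hom D L W" "e o2 \<in> hom D K' W" "e o1 \<cdot>\<^bsub>D\<^esub> f = e o0" "e o2 \<cdot>\<^bsub>D\<^esub> g = e o0"
      unfolding is_cocone_def order_cat_def category.simps Field by (auto simp: r_def F_def)
    from univ[OF e'(1,2)] e'(3,4) obtain u where
      u: "u \<in> hom D L' W" "u \<cdot>\<^bsub>D\<^esub> g' = e o1" "u \<cdot>\<^bsub>D\<^esub> f' = e o2"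
      by auto
    show "\<exists>!u. u \<in> hom D L' W \<and> (\<forall>i\<in>Obj (order_cat r). u \<cdot>\<^bsub>D\<^esub> c i = e i)"
    proof (rule ex1I[of _ u])
      have "u \<cdot>\<^bsub>D\<^esub> (g' \<cdot>\<^bsub>D\<^esub> f) = e o0"
        using comp_assoc[OF homs(1,4) u(1)] u e' by simp
      then show "u \<in> hom D L' W \<and> (\<forall>i\<in>Obj (order_cat r). u \<cdot>\<^bsub>D\<^esub> c i = e i)"
        using u unfolding order_cat_def category.simps Field by (auto simp: c_def)
      fix v assume "v \<in> hom D L' W \<and> (\<forall>i\<in>Obj (order_cat r). v \<cdot>\<^bsub>D\<^esub> c i = e i)"
      then have "v \<in> hom D L' W" "v \<cdot>\<^bsub>D\<^esub> g' = e o1" "v \<cdot>\<^bsub>D\<^esub> f' = e o2"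
        unfolding order_cat_def category.simps Field by (auto simp: c_def)
      then show "v = u"
        using univ[OF e'(1,2)] e'(3,4) u by metis
    qed
  qed
  show ?thesis
  proof (rule extends_alongI[OF homs(3)])
    fix \<theta> w
    assume \<theta>: "\<theta> \<in> hom D (fobj H K') A" and w: "\<And>k. k \<in> N \<Longrightarrow> w k \<in> hom D L' A"
      and eq: "\<And>k. k \<in> N \<Longrightarrow> w k \<cdot>\<^bsub>D\<^esub> f' = \<theta> \<cdot>\<^bsub>D\<^esub> d k K'"
    note objs = hom_Obj[OF homs(1)] hom_Obj[OF homs(2)]
    note Hg = functor_hom[OF H_functor homs(2)] and Hf = functor_hom[OF H_functor homs(1)]
    \<comment> \<open>Commutativity of the square and naturality of \<open>d\<close> make the
      restricted data a problem for \<open>f\<close>.\<close>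
    have "(w k \<cdot>\<^bsub>D\<^esub> g') \<cdot>\<^bsub>D\<^esub> f = (\<theta> \<cdot>\<^bsub>D\<^esub> farr H g) \<cdot>\<^bsub>D\<^esub> d k K" if k: "k \<in> N" for k
      using comp_assoc[OF homs(1,4) w[OF k]] comp_assoc[OF homs(2,3) w[OF k]] square eq[OF k]
        comp_assoc[OF homs(2) d_hom[OF k objs(4)] \<theta>] comp_assoc[OF d_hom[OF k objs(1)] Hg \<theta>]
        d_natural[OF k homs(2)] by metis
    from extends_alongE[OF f homs(1) comp_hom[OF Hg \<theta>] comp_hom[OF homs(4) w] this]
    obtain \<Theta> where \<Theta>: "\<Theta> \<in> hom D (fobj H L) A" "\<Theta> \<cdot>\<^bsub>D\<^esub> farr H f = \<theta> \<cdot>\<^bsub>D\<^esub> farr H g"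
      "\<And>k. k \<in> N \<Longrightarrow> \<Theta> \<cdot>\<^bsub>D\<^esub> d k L = w k \<cdot>\<^bsub>D\<^esub> g'"
      by blast
    \<comment> \<open>The value at the apex is the common restriction of the values
      \<open>\<Theta>\<close> and \<open>\<theta>\<close> at the two corners.\<close>
    define x where "x i = (if i = o0 then \<theta> \<cdot>\<^bsub>D\<^esub> farr H g else if i = o1 then \<Theta> else \<theta>)" for i
    obtain y where y: "y \<in> hom D (fobj H L') A" "\<And>k. k \<in> N \<Longrightarrow> y \<cdot>\<^bsub>D\<^esub> d k L' = w k"
      "\<And>i. i \<in> Field r \<Longrightarrow> y \<cdot>\<^bsub>D\<^esub> farr H (c i) = x i"
    proof (rule colimit_extension[OF r Fr F V])
      show "x i \<in> hom D (fobj H (fobj F i)) A" if "i \<in> Field r" for i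
        using that \<theta> \<Theta> comp_hom[OF Hg \<theta>] by (auto simp: Field x_def F_def)
      show "x j \<cdot>\<^bsub>D\<^esub> farr H (farr F (i, j)) = x i" if "(i, j) \<in> r" for i j
        using that comp_one[OF \<theta>] comp_one[OF \<Theta>(1)] comp_one[OF comp_hom[OF Hg \<theta>]]
        by (auto simp: x_def F_def r_def \<Theta> functor_one[OF H_functor] objs)
      show "w k \<in> hom D L' A" if "k \<in> N" for k using that by (rule w)
      show "A \<in> Obj D" using \<theta> hom_Obj by blast
      show "x i \<cdot>\<^bsub>D\<^esub> d k (fobj F i) = w k \<cdot>\<^bsub>D\<^esub> c i" if "i \<in> Field r" "k \<in> N" for i k
        using that \<Theta> eq \<open>\<And>k. k \<in> N \<Longrightarrow> (w k \<cdot>\<^bsub>D\<^esub> g') \<cdot>\<^bsub>D\<^esub> f = (\<theta> \<cdot>\<^bsub>D\<^esub> farr H g) \<cdot>\<^bsub>D\<^esub> d k K\<close>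
          comp_assoc[OF homs(1,4) w[OF that(2)]]
        by (auto simp: Field x_def F_def c_def)
    qed blast
    from y(3)[of o2] have "y \<cdot>\<^bsub>D\<^esub> farr H f' = \<theta>"
      by (simp add: Field c_def x_def)
    then show "\<exists>\<Theta> \<in> hom D (fobj H L') A. \<Theta> \<cdot>\<^bsub>D\<^esub> farr H f' = \<theta> \<and> (\<forall>k\<in>N. \<Theta> \<cdot>\<^bsub>D\<^esub> d k L' = w k)"
      using y by blast
  qed
qed

text \<open>Compose the data with the retractions \<open>s\<close> and \<open>s'\<close> to get a
  problem for \<open>g\<close>, then compose its solution with \<open>H\<close> applied to the
  section \<open>i'\<close>. The identities \<open>si\<close> and \<open>si'\<close> cancel the
  detour.\<close>

lemma extends_along_retract:
  assumes g: "extends_along D H N d A g" and "is_retract D f g"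
  shows "extends_along D H N d A f"
proof -
  define X Y X' Y' where "X = src D f" and "Y = tgt D f" and "X' = src D g" and "Y' = tgt D g"
  note defs = this
  from assms obtain i s i' s' where f: "f \<in> hom D X Y" and g': "g \<in> hom D X' Y'"
    and i: "i \<in> hom D X X'" and s: "s \<in> hom D X' X" and i': "i' \<in> hom D Y Y'" and s': "s' \<in> hom D Y' Y"
    and si: "s \<cdot>\<^bsub>D\<^esub> i = one D X" and si': "s' \<cdot>\<^bsub>D\<^esub> i' = one D Y"
    and gi: "g \<cdot>\<^bsub>D\<^esub> i = i' \<cdot>\<^bsub>D\<^esub> f" and fs: "f \<cdot>\<^bsub>D\<^esub> s = s' \<cdot>\<^bsub>D\<^esub> g"
    unfolding is_retract_def defs by (auto simp: Arr_hom)
  note H = functor_hom[OF H_functor]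
  note objs = hom_Obj[OF f] hom_Obj[OF g']
  show ?thesis
  proof (rule extends_alongI[OF f])
    fix \<theta> w
    assume \<theta>: "\<theta> \<in> hom D (fobj H X) A" and w: "\<And>k. k \<in> N \<Longrightarrow> w k \<in> hom D Y A"
      and eq: "\<And>k. k \<in> N \<Longrightarrow> w k \<cdot>\<^bsub>D\<^esub> f = \<theta> \<cdot>\<^bsub>D\<^esub> d k X"
    have "(w k \<cdot>\<^bsub>D\<^esub> s') \<cdot>\<^bsub>D\<^esub> g = (\<theta> \<cdot>\<^bsub>D\<^esub> farr H s) \<cdot>\<^bsub>D\<^esub> d k X'" if k: "k \<in> N" for k
      using comp_assoc[OF g' s' w[OF k]] comp_assoc[OF s f w[OF k]] fs eq[OF k]
        comp_assoc[OF s d_hom[OF k objs(1)] \<theta>] comp_assoc[OF d_hom[OF k objs(3)] H[OF s] \<theta>] d_natural[OF k s]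
      by metis
    from extends_alongE[OF g g' comp_hom[OF H[OF s] \<theta>] comp_hom[OF s' w] this]
    obtain \<Theta> where \<Theta>: "\<Theta> \<in> hom D (fobj H Y') A" "\<Theta> \<cdot>\<^bsub>D\<^esub> farr H g = \<theta> \<cdot>\<^bsub>D\<^esub> farr H s"
      "\<And>k. k \<in> N \<Longrightarrow> \<Theta> \<cdot>\<^bsub>D\<^esub> d k Y' = w k \<cdot>\<^bsub>D\<^esub> s'"
      by blast
    have "(\<Theta> \<cdot>\<^bsub>D\<^esub> farr H i') \<cdot>\<^bsub>D\<^esub> farr H f = \<Theta> \<cdot>\<^bsub>D\<^esub> farr H (i' \<cdot>\<^bsub>D\<^esub> f)"
      using comp_assoc[OF H[OF f] H[OF i'] \<Theta>(1)] functor_comp[OF H_functor f i'] by simp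
    also have "\<dots> = (\<Theta> \<cdot>\<^bsub>D\<^esub> farr H g) \<cdot>\<^bsub>D\<^esub> farr H i"
      using comp_assoc[OF H[OF i] H[OF g'] \<Theta>(1)] functor_comp[OF H_functor i g'] gi by simp
    also have "\<dots> = \<theta> \<cdot>\<^bsub>D\<^esub> farr H (s \<cdot>\<^bsub>D\<^esub> i)"
      using comp_assoc[OF H[OF i] H[OF s] \<theta>] functor_comp[OF H_functor i s] \<Theta> by simp
    also have "\<dots> = \<theta>"
      using si functor_one[OF H_functor objs(1)] comp_one[OF \<theta>] by simp
    finally have 1: "(\<Theta> \<cdot>\<^bsub>D\<^esub> farr H i') \<cdot>\<^bsub>D\<^esub> farr H f = \<theta>" .
    have 2: "(\<Theta> \<cdot>\<^bsub>D\<^esub> farr H i') \<cdot>\<^bsub>D\<^esub> d k Y = w k" if k: "k \<in> N" for k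
    proof -
      have "(\<Theta> \<cdot>\<^bsub>D\<^esub> farr H i') \<cdot>\<^bsub>D\<^esub> d k Y = (w k \<cdot>\<^bsub>D\<^esub> s') \<cdot>\<^bsub>D\<^esub> i'"
        using comp_assoc[OF d_hom[OF k objs(2)] H[OF i'] \<Theta>(1)] d_natural[OF k i']
          comp_assoc[OF i' d_hom[OF k objs(4)] \<Theta>(1)] \<Theta>(3)[OF k] by metis
      also have "\<dots> = w k"
        using comp_assoc[OF i' s' w[OF k]] si' comp_one[OF w[OF k]] by metis
      finally show ?thesis .
    qed
    show "\<exists>\<Theta> \<in> hom D (fobj H Y) A. \<Theta> \<cdot>\<^bsub>D\<^esub> farr H f = \<theta> \<and> (\<forall>k\<in>N. \<Theta> \<cdot>\<^bsub>D\<^esub> d k Y = w k)"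
      using 1 2 comp_hom[OF H[OF i'] \<Theta>(1)] by blast
  qed
qed

text \<open>Well-founded recursion along the order: at stage \<open>j\<close> the maps on the
  colimit prescribe the ends, through \<open>c j\<close>, and the solution must restrict to all
  earlier ones. Successor stages extend along one link of the sequence, limit stages glue by
  continuity, and a last gluing over all of \<open>r\<close> reaches \<open>V\<close>.\<close>

lemma extends_along_transfinite:
  assumes "transfinite_composite U D {f. extends_along D H N d A f} f"
  shows "extends_along D H N d A f"
proof -
  from assms obtain r :: "'u rel" and F V c b where
    r: "Well_order r" and Fr: "Field r \<in> U" and F: "is_functor (order_cat r) D F"
    and successor: "\<And>i j. is_successor r i j \<Longrightarrow> extends_along D H N d A (farr F (i, j))"
    and limit: "\<And>j. is_limit r j \<Longrightarrow>
        is_colimit (order_cat (Restr r (underS r j))) D F (fobj F j) (\<lambda>i. farr F (i, j))"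
    and V: "is_colimit (order_cat r) D F V c" and b: "is_bottom r b" and f: "f = c b"
    unfolding transfinite_composite_def small_iff by blast
  have po: "Preorder r" and antisym: "antisym r" and total: "Total r" and wf: "wf (r - Id)"
    using r by (auto simp: well_order_on_def linear_order_on_def partial_order_on_def)
  note refl = Preorder_closed(1)[OF po] and trans = Preorder_closed(2)[OF po]
  have bF: "b \<in> Field r" using b by (simp add: is_bottom_def)
  have Fhom: "farr F (i, j) \<in> hom D (fobj F i) (fobj F j)" if "(i, j) \<in> r" for i j
    using functor_hom[OF F, of "(i, j)" i j] that by (simp add: order_cat_def hom_def)
  have Fcomp: "farr F (i, k) = farr F (j, k) \<cdot>\<^bsub>D\<^esub> farr F (i, j)" if "(i, j) \<in> r" "(j, k) \<in> r" for i j k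
    using functor_comp[OF F, of "(i, j)" i j "(j, k)" k] that by (simp add: order_cat_def hom_def)
  have Fone: "farr F (i, i) = one D (fobj F i)" "fobj F i \<in> Obj D" if "i \<in> Field r" for i
    using F that by (auto simp: order_cat_def is_functor_def)
  have c: "c i \<in> hom D (fobj F i) V" if "i \<in> Field r" for i
    using V that by (auto simp: is_colimit_def is_cocone_def order_cat_def)
  have cF: "c j \<cdot>\<^bsub>D\<^esub> farr F (i, j) = c i" if "(i, j) \<in> r" for i j
    using V that by (auto simp: is_colimit_def is_cocone_def order_cat_def)
  note H = functor_hom[OF H_functor]
  show ?thesis
  proof (rule extends_alongI[of f D "fobj F b" V])
    show "f \<in> hom D (fobj F b) V" using c bF f by simp
    fix \<theta> w
    assume \<theta>: "\<theta> \<in> hom D (fobj H (fobj F b)) A" and w: "\<And>k. k \<in> N \<Longrightarrow> w k \<in> hom D V A"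
      and eq: "\<And>k. k \<in> N \<Longrightarrow> w k \<cdot>\<^bsub>D\<^esub> f = \<theta> \<cdot>\<^bsub>D\<^esub> d k (fobj F b)"
    have A: "A \<in> Obj D" using \<theta> hom_Obj by blast
    \<comment> \<open>Admissible values \<open>y\<close> at stage \<open>j\<close>, given the
      earlier values \<open>x\<close>. The predicate is vacuous off \<open>Field r\<close>, so that
      the recursion may run over the whole type; its last clause starts the recursion at
      \<open>\<theta>\<close>.\<close>
    define P where "P x j y \<longleftrightarrow> (j \<in> Field r \<longrightarrow> y \<in> hom D (fobj H (fobj F j)) A \<and>
      (\<forall>i\<in>underS r j. y \<cdot>\<^bsub>D\<^esub> farr H (farr F (i, j)) = x i) \<and>
      (\<forall>k\<in>N. y \<cdot>\<^bsub>D\<^esub> d k (fobj F j) = w k \<cdot>\<^bsub>D\<^esub> c j) \<and> (j = b \<longrightarrow> y = \<theta>))" for x j y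
    have "\<exists>y. P x j y" if x: "\<And>i. (i, j) \<in> r - Id \<Longrightarrow> P x i (x i)" for x j
    proof (cases "j \<in> Field r")
      case j: True
      have hom: "x i \<in> hom D (fobj H (fobj F i)) A"
        and comp: "\<And>h. h \<in> underS r i \<Longrightarrow> x i \<cdot>\<^bsub>D\<^esub> farr H (farr F (h, i)) = x h"
        and xw: "\<And>k. k \<in> N \<Longrightarrow> x i \<cdot>\<^bsub>D\<^esub> d k (fobj F i) = w k \<cdot>\<^bsub>D\<^esub> c i"
        if "i \<in> underS r j" for i
        using that x[of i] by (auto simp: underS_def P_def FieldI1)
      \<comment> \<open>This adds the reflexive case, which \<open>underS\<close> leaves out and
        which holds because functors preserve identities.\<close>
      have comp': "x i \<cdot>\<^bsub>D\<^esub> farr H (farr F (h, i)) = x h" if "i \<in> underS r j" "(h, i) \<in> r" for h i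
      proof (cases "h = i")
        case True
        then have i: "i \<in> Field r" using that by (auto simp: Field_def)
        show ?thesis
          using comp_one[OF hom[OF that(1)]] True Fone[OF i] functor_one[OF H_functor] by simp
      qed (use that comp in \<open>auto simp: underS_def\<close>)
      consider "is_bottom r j" | i where "is_successor r i j" | "is_limit r j"
        using j by (auto simp: is_limit_def)
      then show ?thesis
      proof cases
        case 1
        then have "j = b"
          using b total j bF unfolding is_bottom_def total_on_def underS_def by blast
        then have "P x j \<theta>"
          using 1 \<theta> eq f by (simp add: P_def is_bottom_def)
        then show ?thesis ..
      next
        case 2
        then have ij: "(i, j) \<in> r" "i \<noteq> j" and i: "i \<in> underS r j" "i \<in> Field r"
          by (auto simp: is_successor_def underS_def Field_def)
        \<comment> \<open>By totality, an \<open>h\<close> before \<open>j\<close> but not weakly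
          before \<open>i\<close> would lie strictly between \<open>i\<close> and its successor
          \<open>j\<close>. So compatibility has to be arranged at \<open>i\<close> only and
          propagates downwards by functoriality.\<close>
        have below: "(h, i) \<in> r" if "h \<in> underS r j" for h
          using that 2 total i refl unfolding is_successor_def total_on_def underS_def
          by (metis (mono_tags, lifting) FieldI1 mem_Collect_eq)
        have "(w k \<cdot>\<^bsub>D\<^esub> c j) \<cdot>\<^bsub>D\<^esub> farr F (i, j) = x i \<cdot>\<^bsub>D\<^esub> d k (fobj F i)" if "k \<in> N" for k
          using comp_assoc[OF Fhom[OF ij(1)] c[OF j] w[OF that]] cF[OF ij(1)] xw[OF i(1) that] by simp
        from extends_alongE[OF successor[OF 2] Fhom[OF ij(1)] hom[OF i(1)] comp_hom[OF c[OF j] w] this]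
        obtain y where y: "y \<in> hom D (fobj H (fobj F j)) A" "y \<cdot>\<^bsub>D\<^esub> farr H (farr F (i, j)) = x i"
          "\<And>k. k \<in> N \<Longrightarrow> y \<cdot>\<^bsub>D\<^esub> d k (fobj F j) = w k \<cdot>\<^bsub>D\<^esub> c j"
          by blast
        have "y \<cdot>\<^bsub>D\<^esub> farr H (farr F (h, j)) = x h" if "h \<in> underS r j" for h
        proof -
          note hi = below[OF that]
          have "y \<cdot>\<^bsub>D\<^esub> farr H (farr F (h, j)) = (y \<cdot>\<^bsub>D\<^esub> farr H (farr F (i, j))) \<cdot>\<^bsub>D\<^esub> farr H (farr F (h, i))"
            using Fcomp[OF hi ij(1)] functor_comp[OF H_functor Fhom[OF hi] Fhom[OF ij(1)]]
              comp_assoc[OF H[OF Fhom[OF hi]] H[OF Fhom[OF ij(1)]] y(1)] by simp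
          then show ?thesis
            using y(2) comp'[OF i(1) hi] by simp
        qed
        moreover have "j \<noteq> b"
          using b i(1) by (auto simp: is_bottom_def)
        ultimately have "P x j y"
          using y by (simp add: P_def)
        then show ?thesis ..
      next
        case 3
        \<comment> \<open>Continuity presents the stage at \<open>j\<close> as a colimit over its
          strict initial segment, so the values already chosen there glue to one at
          \<open>j\<close>.\<close>
        define s where "s = Restr r (underS r j)"
        have under: "underS r j \<subseteq> Field r"
          by (auto simp: underS_def Field_def)
        have Fs: "Field s = underS r j"
        proof
          show "Field s \<subseteq> underS r j"
            by (auto simp: s_def Field_def)
          show "underS r j \<subseteq> Field s"
          proof
            fix i assume i: "i \<in> underS r j"
            then have "(i, i) \<in> s"
              using refl under by (auto simp: s_def)
            then show "i \<in> Field s"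
              by (rule FieldI1)
          qed
        qed
        have s: "Preorder s" "Field s \<in> U"
          using refl trans under subset[OF Fr under]
          by (auto simp: preorder_on_def Fs refl_on_def trans_def) (auto simp: s_def)
        have "is_functor (order_cat s) D F"
          using F under Fs unfolding is_functor_def order_cat_def by (auto simp: s_def)
        then obtain y where y: "y \<in> hom D (fobj H (fobj F j)) A"
          "\<And>k. k \<in> N \<Longrightarrow> y \<cdot>\<^bsub>D\<^esub> d k (fobj F j) = w k \<cdot>\<^bsub>D\<^esub> c j"
          "\<And>i. i \<in> Field s \<Longrightarrow> y \<cdot>\<^bsub>D\<^esub> farr H (farr F (i, j)) = x i"
        proof (rule colimit_extension[OF s _ limit[OF 3, folded s_def]])
          show "x i \<in> hom D (fobj H (fobj F i)) A" if "i \<in> Field s" for i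
            using that hom Fs by simp
          show "x i \<cdot>\<^bsub>D\<^esub> farr H (farr F (h, i)) = x h" if "(h, i) \<in> s" for h i
            using that comp' by (simp add: s_def)
          show "w k \<cdot>\<^bsub>D\<^esub> c j \<in> hom D (fobj F j) A" if "k \<in> N" for k
            using comp_hom[OF c[OF j] w[OF that]] .
          show "x i \<cdot>\<^bsub>D\<^esub> d k (fobj F i) = w k \<cdot>\<^bsub>D\<^esub> c j \<cdot>\<^bsub>D\<^esub> farr F (i, j)" if "i \<in> Field s" "k \<in> N" for i k
          proof -
            have ij: "(i, j) \<in> r" using that Fs by (simp add: underS_def)
            show ?thesis
              using xw comp_assoc[OF Fhom[OF ij] c[OF j] w[OF that(2)]] cF[OF ij] that Fs by simp
          qed
        qed (use A in auto)
        moreover have "j \<noteq> b"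
          using 3 b by (auto simp: is_limit_def)
        ultimately have "P x j y"
          using Fs by (simp add: P_def)
        then show ?thesis ..
      qed
    qed (simp add: P_def)
    \<comment> \<open>\<open>P x j\<close> reads \<open>x\<close> only strictly below
      \<open>j\<close>; this is the locality that \<open>dependent_wf_choice\<close>
      demands.\<close>
    moreover have "P x j y = P x' j y" if "\<And>i. (i, j) \<in> r - Id \<Longrightarrow> x i = x' i" for x x' j y
      using that by (auto simp: P_def underS_def)
    ultimately have "\<exists>x. \<forall>j. P x j (x j)"
      by (intro dependent_wf_choice[OF wf]) blast+
    then obtain x where "\<And>j. P x j (x j)"
      by blast
    then have hom: "x i \<in> hom D (fobj H (fobj F i)) A"
      and comp: "\<And>h. h \<in> underS r i \<Longrightarrow> x i \<cdot>\<^bsub>D\<^esub> farr H (farr F (h, i)) = x h"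
      and xw: "\<And>k. k \<in> N \<Longrightarrow> x i \<cdot>\<^bsub>D\<^esub> d k (fobj F i) = w k \<cdot>\<^bsub>D\<^esub> c i" and xb: "x b = \<theta>"
      if "i \<in> Field r" for i
      using that bF by (auto simp: P_def)
    obtain y where y: "y \<in> hom D (fobj H V) A" "\<And>k. k \<in> N \<Longrightarrow> y \<cdot>\<^bsub>D\<^esub> d k V = w k"
      "\<And>i. i \<in> Field r \<Longrightarrow> y \<cdot>\<^bsub>D\<^esub> farr H (c i) = x i"
    proof (rule colimit_extension[OF po Fr F V hom])
      show "x i \<cdot>\<^bsub>D\<^esub> farr H (farr F (h, i)) = x h" if "(h, i) \<in> r" for h i
      proof (cases "h = i")
        case True
        then have i: "i \<in> Field r" using that by (auto simp: Field_def)
        show ?thesis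
          using comp_one[OF hom[OF i]] True Fone[OF i] functor_one[OF H_functor] by simp
      qed (use that comp in \<open>auto simp: underS_def Field_def\<close>)
    qed (use w xw A in auto)
    then show "\<exists>\<Theta> \<in> hom D (fobj H V) A. \<Theta> \<cdot>\<^bsub>D\<^esub> farr H f = \<theta> \<and> (\<forall>k\<in>N. \<Theta> \<cdot>\<^bsub>D\<^esub> d k V = w k)"
      using bF f xb by blast
  qed
qed

lemma saturated_extends_along: "saturated U D {f. extends_along D H N d A f}"
  unfolding saturated_def mem_Collect_eq
proof (intro conjI allI impI)
  show "{f. extends_along D H N d A f} \<subseteq> Arr D"
    by (auto simp: extends_along_def)
  show "extends_along D H N d A f'" if "extends_along D H N d A f \<and> is_pushout D f g f' g'" for f g f' g'
    using that extends_along_pushout by blast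
  show "extends_along D H N d A f" if "transfinite_composite U D {f. extends_along D H N d A f} f" for f
    using that by (rule extends_along_transfinite)
  show "extends_along D H N d A f" if "extends_along D H N d A g \<and> is_retract D f g" for f g
    using that extends_along_retract by blast
qed

lemma saturation_extends_along:
  assumes "\<And>f. f \<in> S \<Longrightarrow> extends_along D H N d A f" "f \<in> saturation U D S"
  shows "extends_along D H N d A f"
proof -
  have "saturation U D S \<subseteq> {f. extends_along D H N d A f}"
    unfolding saturation_def using assms(1) saturated_extends_along by (intro Inter_lower) auto
  then show ?thesis using assms(2) by blast
qed

end

section \<open>Presheaves\<close>

lemma PSh_sel [simp]:
  "Obj (PSh U C) = {X. is_presheaf U C X}" "Arr (PSh U C) = {f. is_presheaf_map U C f}"
  "src (PSh U C) = msrc" "tgt (PSh U C) = mtgt"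
  by (simp_all add: PSh_def)

lemma PSh_hom: "f \<in> hom (PSh U C) X Y \<longleftrightarrow> is_presheaf_map U C f \<and> msrc f = X \<and> mtgt f = Y"
  by (simp add: hom_def)

lemma PSh_comp_sel [simp]:
  "msrc (g \<cdot>\<^bsub>PSh U C\<^esub> f) = msrc f" "mtgt (g \<cdot>\<^bsub>PSh U C\<^esub> f) = mtgt g"
  by (simp_all add: PSh_def)

lemma PSh_comp_app [simp]:
  "c \<in> Obj C \<Longrightarrow> x \<in> sec (msrc f) c \<Longrightarrow> app (g \<cdot>\<^bsub>PSh U C\<^esub> f) c x = app g c (app f c x)"
  by (simp add: PSh_def)

lemma PSh_one_sel [simp]: "msrc (one (PSh U C) X) = X" "mtgt (one (PSh U C) X) = X"
  by (simp_all add: PSh_def)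

lemma PSh_one_app [simp]: "c \<in> Obj C \<Longrightarrow> x \<in> sec X c \<Longrightarrow> app (one (PSh U C) X) c x = x"
  by (simp add: PSh_def)

section \<open>Extensional presheaves and their maps, and the category they form\<close>

lemma is_presheafI:
  assumes "sec X \<in> extensional (Obj C)" "res X \<in> extensional (Arr C)"
    and "\<And>c. c \<in> Obj C \<Longrightarrow> sec X c \<in> U"
    and "\<And>a. a \<in> Arr C \<Longrightarrow> res X a \<in> extensional (sec X (tgt C a))"
    and "\<And>a x. a \<in> Arr C \<Longrightarrow> x \<in> sec X (tgt C a) \<Longrightarrow> res X a x \<in> sec X (src C a)"
    and "\<And>c x. c \<in> Obj C \<Longrightarrow> x \<in> sec X c \<Longrightarrow> res X (one C c) x = x"
    and "\<And>a b x. a \<in> Arr C \<Longrightarrow> b \<in> Arr C \<Longrightarrow> tgt C a = src C b \<Longrightarrow> x \<in> sec X (tgt C b) \<Longrightarrow>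
      res X (b \<cdot>\<^bsub>C\<^esub> a) x = res X a (res X b x)"
  shows "is_presheaf U C X"
  using assms unfolding is_presheaf_def PiE_def by auto

lemma is_presheafD:
  assumes "is_presheaf U C X"
  shows "sec X \<in> extensional (Obj C)" "res X \<in> extensional (Arr C)"
    and "c \<in> Obj C \<Longrightarrow> sec X c \<in> U"
    and "a \<in> Arr C \<Longrightarrow> res X a \<in> extensional (sec X (tgt C a))"
    and "a \<in> Arr C \<Longrightarrow> x \<in> sec X (tgt C a) \<Longrightarrow> res X a x \<in> sec X (src C a)"
    and "c \<in> Obj C \<Longrightarrow> x \<in> sec X c \<Longrightarrow> res X (one C c) x = x"
    and "a \<in> Arr C \<Longrightarrow> b \<in> Arr C \<Longrightarrow> tgt C a = src C b \<Longrightarrow> x \<in> sec X (tgt C b) \<Longrightarrow>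
      res X (b \<cdot>\<^bsub>C\<^esub> a) x = res X a (res X b x)"
  using assms unfolding is_presheaf_def PiE_def Pi_def by auto

lemma is_presheaf_mapI:
  assumes "is_presheaf U C (msrc f)" "is_presheaf U C (mtgt f)" "app f \<in> extensional (Obj C)"
    and "\<And>c. c \<in> Obj C \<Longrightarrow> app f c \<in> extensional (sec (msrc f) c)"
    and "\<And>c x. c \<in> Obj C \<Longrightarrow> x \<in> sec (msrc f) c \<Longrightarrow> app f c x \<in> sec (mtgt f) c"
    and "\<And>a x. a \<in> Arr C \<Longrightarrow> x \<in> sec (msrc f) (tgt C a) \<Longrightarrow>
      app f (src C a) (res (msrc f) a x) = res (mtgt f) a (app f (tgt C a) x)"
  shows "is_presheaf_map U C f"
  using assms unfolding is_presheaf_map_def PiE_def by auto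

lemma is_presheaf_mapD:
  assumes "is_presheaf_map U C f"
  shows "is_presheaf U C (msrc f)" "is_presheaf U C (mtgt f)" "app f \<in> extensional (Obj C)"
    and "c \<in> Obj C \<Longrightarrow> app f c \<in> extensional (sec (msrc f) c)"
    and "c \<in> Obj C \<Longrightarrow> x \<in> sec (msrc f) c \<Longrightarrow> app f c x \<in> sec (mtgt f) c"
    and "a \<in> Arr C \<Longrightarrow> x \<in> sec (msrc f) (tgt C a) \<Longrightarrow>
      app f (src C a) (res (msrc f) a x) = res (mtgt f) a (app f (tgt C a) x)"
  using assms unfolding is_presheaf_map_def PiE_def Pi_def by auto

lemma presheaf_map_eqI:
  assumes f: "is_presheaf_map U C f" and g: "is_presheaf_map U C g"
    and "msrc f = msrc g" "mtgt f = mtgt g"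
    and eq: "\<And>c x. c \<in> Obj C \<Longrightarrow> x \<in> sec (msrc f) c \<Longrightarrow> app f c x = app g c x"
  shows "f = g"
proof -
  have "app f c = app g c" if "c \<in> Obj C" for c
    using is_presheaf_mapD(4)[OF f that] is_presheaf_mapD(4)[OF g that] eq[OF that] assms(3)
    by (metis extensionalityI)
  then have "app f = app g"
    using is_presheaf_mapD(3)[OF f] is_presheaf_mapD(3)[OF g] by (metis extensionalityI)
  with assms(3,4) show ?thesis by (cases f, cases g) simp
qed

lemma is_presheaf_map_comp:
  assumes C: "category C" and f: "is_presheaf_map U C f" and g: "is_presheaf_map U C g"
    and fg: "mtgt f = msrc g"
  shows "is_presheaf_map U C (g \<cdot>\<^bsub>PSh U C\<^esub> f)"
proof -
  interpret category C by fact
  note fD = is_presheaf_mapD[OF f] and gD = is_presheaf_mapD[OF g]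
  show ?thesis
  proof (rule is_presheaf_mapI)
    show "app (g \<cdot>\<^bsub>PSh U C\<^esub> f) (src C a) (res (msrc (g \<cdot>\<^bsub>PSh U C\<^esub> f)) a x) =
        res (mtgt (g \<cdot>\<^bsub>PSh U C\<^esub> f)) a (app (g \<cdot>\<^bsub>PSh U C\<^esub> f) (tgt C a) x)"
      if "a \<in> Arr C" "x \<in> sec (msrc (g \<cdot>\<^bsub>PSh U C\<^esub> f)) (tgt C a)" for a x
      using that fD gD fg is_presheafD(5)[OF fD(1)] src_obj tgt_obj by simp
  qed (use fD gD fg in \<open>auto simp: PSh_def\<close>)
qed

lemma is_presheaf_map_one:
  assumes C: "category C" and X: "is_presheaf U C X"
  shows "is_presheaf_map U C (one (PSh U C) X)"
proof -
  interpret category C by fact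
  show ?thesis
    by (rule is_presheaf_mapI)
      (use X is_presheafD(5)[OF X] src_obj tgt_obj in \<open>auto simp: PSh_def\<close>)
qed

lemma category_PSh:
  assumes C: "category C"
  shows "category (PSh U C)"
proof
  note comp = is_presheaf_map_comp[OF C, where U = U] and one = is_presheaf_map_one[OF C, where U = U]
  show "f \<in> Arr (PSh U C) \<Longrightarrow> src (PSh U C) f \<in> Obj (PSh U C)"
    and "f \<in> Arr (PSh U C) \<Longrightarrow> tgt (PSh U C) f \<in> Obj (PSh U C)" for f
    by (auto dest: is_presheaf_mapD)
  show "X \<in> Obj (PSh U C) \<Longrightarrow> one (PSh U C) X \<in> hom (PSh U C) X X" for X
    using one by (auto simp: PSh_hom)
  show "g \<cdot>\<^bsub>PSh U C\<^esub> f \<in> hom (PSh U C) X Z"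
    if "f \<in> hom (PSh U C) X Y" "g \<in> hom (PSh U C) Y Z" for f g X Y Z
    using that comp by (auto simp: PSh_hom)
  show "f \<cdot>\<^bsub>PSh U C\<^esub> one (PSh U C) X = f" if "f \<in> hom (PSh U C) X Y" for f X Y
    using that by (intro presheaf_map_eqI[of U C]) (auto simp: PSh_hom dest: is_presheaf_mapD intro!: comp one)
  show "one (PSh U C) Y \<cdot>\<^bsub>PSh U C\<^esub> f = f" if "f \<in> hom (PSh U C) X Y" for f X Y
    using that by (intro presheaf_map_eqI[of U C]) (auto simp: PSh_hom dest: is_presheaf_mapD intro!: comp one)
  show "h \<cdot>\<^bsub>PSh U C\<^esub> (g \<cdot>\<^bsub>PSh U C\<^esub> f) = h \<cdot>\<^bsub>PSh U C\<^esub> g \<cdot>\<^bsub>PSh U C\<^esub> f"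
    if "f \<in> hom (PSh U C) W X" "g \<in> hom (PSh U C) X Y" "h \<in> hom (PSh U C) Y Z" for f g h W X Y Z
    using that
    by (intro presheaf_map_eqI[of U C]) (auto simp: PSh_hom dest: is_presheaf_mapD intro!: comp)
qed

lemma is_presheaf_subpresheaf:
  assumes C: "category C" and U: "set_universe U" and X: "is_presheaf U C X"
    and sub: "\<And>c. c \<in> Obj C \<Longrightarrow> B c \<subseteq> sec X c"
    and stable: "\<And>a x. a \<in> Arr C \<Longrightarrow> x \<in> B (tgt C a) \<Longrightarrow> res X a x \<in> B (src C a)"
  shows "is_presheaf U C (subpresheaf C X B)"
proof -
  interpret category C by fact
  interpret set_universe U by fact
  note XD = is_presheafD[OF X]
  have one: "one C c \<in> Arr C" "src C (one C c) = c" "tgt C (one C c) = c" if "c \<in> Obj C" for c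
    using one_hom[OF that] by (auto simp: hom_def)
  have comp: "b \<cdot>\<^bsub>C\<^esub> a \<in> Arr C" "src C (b \<cdot>\<^bsub>C\<^esub> a) = src C a" "tgt C (b \<cdot>\<^bsub>C\<^esub> a) = tgt C b"
    if "a \<in> Arr C" "b \<in> Arr C" "tgt C a = src C b" for a b
    using comp_hom[of a "src C a" "tgt C a" b "tgt C b"] that by (auto simp: hom_def)
  show ?thesis
  proof (rule is_presheafI)
    show "sec (subpresheaf C X B) c \<in> U" if "c \<in> Obj C" for c
      using subset[OF XD(3)[OF that] sub[OF that]] that by (simp add: subpresheaf_def)
    show "res (subpresheaf C X B) (b \<cdot>\<^bsub>C\<^esub> a) x = res (subpresheaf C X B) a (res (subpresheaf C X B) b x)"
      if "a \<in> Arr C" "b \<in> Arr C" "tgt C a = src C b" "x \<in> sec (subpresheaf C X B) (tgt C b)" for a b x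
    proof -
      have x: "x \<in> B (tgt C b)"
        using that tgt_obj by (simp add: subpresheaf_def)
      then have "res X b x \<in> B (tgt C a)"
        using stable[OF that(2)] that(3) by simp
      moreover have "x \<in> sec X (tgt C b)"
        using x sub tgt_obj[OF that(2)] by blast
      ultimately show ?thesis
        using XD(7)[OF that(1-3)] x that comp[OF that(1-3)] by (simp add: subpresheaf_def)
    qed
    show "res (subpresheaf C X B) (one C c) x = x" if "c \<in> Obj C" "x \<in> sec (subpresheaf C X B) c" for c x
      using that XD(6)[OF that(1)] sub[OF that(1)] one[OF that(1)] by (auto simp: subpresheaf_def)
  qed (use stable src_obj tgt_obj in \<open>auto simp: subpresheaf_def\<close>)
qed

lemma is_presheaf_map_inclusion:
  assumes C: "category C" and U: "set_universe U" and X: "is_presheaf U C X"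
    and sub: "\<And>c. c \<in> Obj C \<Longrightarrow> B c \<subseteq> sec X c"
    and stable: "\<And>a x. a \<in> Arr C \<Longrightarrow> x \<in> B (tgt C a) \<Longrightarrow> res X a x \<in> B (src C a)"
  shows "is_presheaf_map U C (inclusion C X B)"
proof -
  interpret category C by fact
  show ?thesis
  proof (rule is_presheaf_mapI)
    show "is_presheaf U C (msrc (inclusion C X B))"
      using is_presheaf_subpresheaf[OF assms] by (simp add: inclusion_def)
    show "app (inclusion C X B) c x \<in> sec (mtgt (inclusion C X B)) c"
      if "c \<in> Obj C" "x \<in> sec (msrc (inclusion C X B)) c" for c x
      using that sub[OF that(1)] by (auto simp: inclusion_def subpresheaf_def)
  qed (use X stable src_obj tgt_obj in \<open>auto simp: inclusion_def subpresheaf_def\<close>)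
qed

text \<open>Here and in \<open>mk_map\<close> raw data are cut down to their domains. Extensionality
  then holds by construction, and only membership and the presheaf or naturality equations remain to
  be checked.\<close>

definition mk_presheaf ::
    "('o, 'm) category \<Rightarrow> ('o \<Rightarrow> 'u set) \<Rightarrow> ('m \<Rightarrow> 'u \<Rightarrow> 'u) \<Rightarrow> ('o, 'm, 'u) presheaf" where
  "mk_presheaf C S R = \<lparr>sec = (\<lambda>c\<in>Obj C. S c), res = (\<lambda>a\<in>Arr C. \<lambda>x\<in>S (tgt C a). R a x)\<rparr>"

definition mk_map :: "('o, 'm) category \<Rightarrow> ('o, 'm, 'u) presheaf \<Rightarrow> ('o, 'm, 'u) presheaf \<Rightarrow>
    ('o \<Rightarrow> 'u \<Rightarrow> 'u) \<Rightarrow> ('o, 'm, 'u) presheaf_map" where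
  "mk_map C X Y \<phi> = \<lparr>msrc = X, mtgt = Y, app = (\<lambda>c\<in>Obj C. \<lambda>x\<in>sec X c. \<phi> c x)\<rparr>"

lemma mk_map_sel [simp]:
  "msrc (mk_map C X Y \<phi>) = X" "mtgt (mk_map C X Y \<phi>) = Y"
  "c \<in> Obj C \<Longrightarrow> x \<in> sec X c \<Longrightarrow> app (mk_map C X Y \<phi>) c x = \<phi> c x"
  by (simp_all add: mk_map_def)

lemma mk_presheaf_sel [simp]:
  "c \<in> Obj C \<Longrightarrow> sec (mk_presheaf C S R) c = S c"
  "a \<in> Arr C \<Longrightarrow> x \<in> S (tgt C a) \<Longrightarrow> res (mk_presheaf C S R) a x = R a x"
  by (simp_all add: mk_presheaf_def)

lemma is_presheaf_map_mk_map:
  assumes C: "category C" and X: "is_presheaf U C X" and Y: "is_presheaf U C Y"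
    and "\<And>c x. c \<in> Obj C \<Longrightarrow> x \<in> sec X c \<Longrightarrow> \<phi> c x \<in> sec Y c"
    and "\<And>a x. a \<in> Arr C \<Longrightarrow> x \<in> sec X (tgt C a) \<Longrightarrow>
      \<phi> (src C a) (res X a x) = res Y a (\<phi> (tgt C a) x)"
  shows "is_presheaf_map U C (mk_map C X Y \<phi>)"
proof -
  interpret category C by fact
  show ?thesis
    by (rule is_presheaf_mapI) (use assms src_obj tgt_obj is_presheafD(5)[OF X] in \<open>auto simp: mk_map_def\<close>)
qed

lemma is_presheaf_mk_presheaf:
  assumes C: "category C" 
    and "\<And>c. c \<in> Obj C \<Longrightarrow> S c \<in> U"
    and stable: "\<And>a x. a \<in> Arr C \<Longrightarrow> x \<in> S (tgt C a) \<Longrightarrow> R a x \<in> S (src C a)"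
    and R1: "\<And>c x. c \<in> Obj C \<Longrightarrow> x \<in> S c \<Longrightarrow> R (one C c) x = x"
    and R2: "\<And>a b x. a \<in> Arr C \<Longrightarrow> b \<in> Arr C \<Longrightarrow> tgt C a = src C b \<Longrightarrow> x \<in> S (tgt C b) \<Longrightarrow>
      R (b \<cdot>\<^bsub>C\<^esub> a) x = R a (R b x)"
  shows "is_presheaf U C (mk_presheaf C S R)"
proof -
  interpret category C by fact
  have one: "one C c \<in> Arr C" "src C (one C c) = c" "tgt C (one C c) = c" if "c \<in> Obj C" for c
    using one_hom[OF that] by (auto simp: hom_def)
  have comp: "b \<cdot>\<^bsub>C\<^esub> a \<in> Arr C" "src C (b \<cdot>\<^bsub>C\<^esub> a) = src C a" "tgt C (b \<cdot>\<^bsub>C\<^esub> a) = tgt C b"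
    if "a \<in> Arr C" "b \<in> Arr C" "tgt C a = src C b" for a b
    using comp_hom[of a "src C a" "tgt C a" b "tgt C b"] that by (auto simp: hom_def)
  show ?thesis
  proof (rule is_presheafI)
    show "res (mk_presheaf C S R) (b \<cdot>\<^bsub>C\<^esub> a) x = res (mk_presheaf C S R) a (res (mk_presheaf C S R) b x)"
      if "a \<in> Arr C" "b \<in> Arr C" "tgt C a = src C b" "x \<in> sec (mk_presheaf C S R) (tgt C b)" for a b x
    proof -
      have "x \<in> S (tgt C b)"
        using that tgt_obj by simp
      then show ?thesis
        using that comp[OF that(1-3)] stable[OF that(2)] R2[OF that(1-3)] by simp
    qed
  qed (use assms one src_obj tgt_obj in \<open>auto simp: mk_presheaf_def\<close>)
qed

section \<open>Fibre products, gluing, terminal objects and coproducts in terms of sections\<close>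

locale presheaves = set_universe U + C: category C
  for U :: "'u set set" and C :: "('o, 'm) category"

sublocale presheaves \<subseteq> PSh: category "PSh U C"
  by (rule category_PSh[OF C.category_axioms])

context presheaves begin

lemmas C_category = C.category_axioms
lemmas comp_map = is_presheaf_map_comp[OF C_category, where U = U]

text \<open>The sections of the fibre product are pairs, coded in the type of the universe by an
  injection.\<close>

lemma fibre_product:
  assumes f: "f \<in> hom (PSh U C) X Z" and g: "g \<in> hom (PSh U C) Y Z"
  obtains P p q where "p \<in> hom (PSh U C) P X" "q \<in> hom (PSh U C) P Y"
    "f \<cdot>\<^bsub>PSh U C\<^esub> p = g \<cdot>\<^bsub>PSh U C\<^esub> q"
    "\<And>c x y. c \<in> Obj C \<Longrightarrow> x \<in> sec X c \<Longrightarrow> y \<in> sec Y c \<Longrightarrow> app f c x = app g c y \<Longrightarrow>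
      \<exists>z\<in>sec P c. app p c z = x \<and> app q c z = y"
proof -
  obtain code :: "'u \<times> 'u \<Rightarrow> 'u" where inj: "inj code"
    using pairing by blast
  define dec where "dec = inv code"
  have [simp]: "dec (code z) = z" for z
    using inj by (simp add: dec_def)
  define S where "S c = code ` {(x, y). x \<in> sec X c \<and> y \<in> sec Y c \<and> app f c x = app g c y}" for c
  define R where "R a z = code (res X a (fst (dec z)), res Y a (snd (dec z)))" for a z
  define P where "P = mk_presheaf C S R"
  have f': "is_presheaf_map U C f" "msrc f = X" "mtgt f = Z"
    and g': "is_presheaf_map U C g" "msrc g = Y" "mtgt g = Z"
    using f g by (simp_all add: PSh_hom)
  note fD = is_presheaf_mapD[OF f'(1), unfolded f'] and gD = is_presheaf_mapD[OF g'(1), unfolded g']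
  note XD = is_presheafD[OF fD(1)] and YD = is_presheafD[OF gD(1)]
  have P: "is_presheaf U C P"
    unfolding P_def
  proof (rule is_presheaf_mk_presheaf[OF C_category])
    show "S c \<in> U" if "c \<in> Obj C" for c
      by (rule subset[OF image_Times[OF XD(3)[OF that] YD(3)[OF that], of code]]) (auto simp: S_def)
    show "R a z \<in> S (src C a)" if "a \<in> Arr C" "z \<in> S (tgt C a)" for a z
      using that XD(5)[OF that(1)] YD(5)[OF that(1)] fD(6)[OF that(1)] gD(6)[OF that(1)]
      by (auto simp: S_def R_def intro!: imageI)
  qed (use XD(6,7) YD(6,7) in \<open>auto simp: S_def R_def\<close>)
  define p where "p = mk_map C P X (\<lambda>c z. fst (dec z))"
  define q where "q = mk_map C P Y (\<lambda>c z. snd (dec z))"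
  have p: "is_presheaf_map U C p"
    unfolding p_def
    by (rule is_presheaf_map_mk_map[OF C_category P fD(1)])
      (use C.src_obj C.tgt_obj in \<open>auto simp: P_def S_def R_def\<close>)
  have q: "is_presheaf_map U C q"
    unfolding q_def
    by (rule is_presheaf_map_mk_map[OF C_category P gD(1)])
      (use C.src_obj C.tgt_obj in \<open>auto simp: P_def S_def R_def\<close>)
  have "f \<cdot>\<^bsub>PSh U C\<^esub> p = g \<cdot>\<^bsub>PSh U C\<^esub> q"
  proof (rule presheaf_map_eqI[of U C])
    show "is_presheaf_map U C (f \<cdot>\<^bsub>PSh U C\<^esub> p)" "is_presheaf_map U C (g \<cdot>\<^bsub>PSh U C\<^esub> q)"
      using f' g' p q by (auto intro!: comp_map simp: p_def q_def)
  qed (auto simp: p_def q_def P_def S_def f' g')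
  moreover have "\<exists>z\<in>sec P c. app p c z = x \<and> app q c z = y"
    if "c \<in> Obj C" "x \<in> sec X c" "y \<in> sec Y c" "app f c x = app g c y" for c x y
  proof -
    have "code (x, y) \<in> sec P c"
      using that by (auto simp: P_def S_def)
    then show ?thesis
      using that by (intro bexI[of _ "code (x, y)"]) (auto simp: p_def q_def)
  qed
  ultimately show ?thesis
    using p q by (intro that[of p P q]) (auto simp: PSh_hom p_def q_def)
qed

text \<open>The two projections of the kernel pair become equal after \<open>f\<close>, hence are
  equal; the section of the kernel pair lying over \<open>x\<close> and \<open>y\<close> then gives
  \<open>x = y\<close>.\<close>

lemma monic_inj:
  assumes f: "monic (PSh U C) f"
    and c: "c \<in> Obj C" and x: "x \<in> sec (msrc f) c" and y: "y \<in> sec (msrc f) c"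
    and eq: "app f c x = app f c y"
  shows "x = y"
proof -
  have f': "f \<in> hom (PSh U C) (msrc f) (mtgt f)"
    using f by (simp add: monic_def PSh_hom)
  obtain P p q where pq: "p \<in> hom (PSh U C) P (msrc f)" "q \<in> hom (PSh U C) P (msrc f)"
    "f \<cdot>\<^bsub>PSh U C\<^esub> p = f \<cdot>\<^bsub>PSh U C\<^esub> q" and z: "\<exists>z\<in>sec P c. app p c z = x \<and> app q c z = y"
    using fibre_product[OF f' f'] c x y eq by metis
  have "p = q"
    using f pq unfolding monic_def by (auto simp: PSh_hom)
  with z show ?thesis by blast
qed

text \<open>A pullback given by its universal property is compared with the explicit fibre product:
  the mediating map carries the pair of \<open>x\<close> and \<open>y\<close> to the wanted
  section.\<close>

lemma pullback_sections:
  assumes pb: "is_pullback (PSh U C) p q f g"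
    and c: "c \<in> Obj C" and x: "x \<in> sec (msrc f) c" and y: "y \<in> sec (msrc g) c"
    and eq: "app f c x = app g c y"
  obtains z where "z \<in> sec (msrc p) c" "app p c z = x" "app q c z = y"
proof -
  have f: "f \<in> hom (PSh U C) (msrc f) (mtgt f)" and g: "g \<in> hom (PSh U C) (msrc g) (mtgt f)"
    using pb by (auto simp: is_pullback_def PSh_hom)
  obtain P h k where hk: "h \<in> hom (PSh U C) P (msrc f)" "k \<in> hom (PSh U C) P (msrc g)"
    "f \<cdot>\<^bsub>PSh U C\<^esub> h = g \<cdot>\<^bsub>PSh U C\<^esub> k" and "\<exists>w\<in>sec P c. app h c w = x \<and> app k c w = y"
    using fibre_product[OF f g] c x y eq by metis
  then obtain w where w: "w \<in> sec P c" "app h c w = x" "app k c w = y"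
    by blast
  obtain u where u: "u \<in> hom (PSh U C) P (msrc p)" "p \<cdot>\<^bsub>PSh U C\<^esub> u = h" "q \<cdot>\<^bsub>PSh U C\<^esub> u = k"
  proof -
    have "\<forall>Q. \<forall>h \<in> hom (PSh U C) Q (msrc f). \<forall>k \<in> hom (PSh U C) Q (msrc g).
      f \<cdot>\<^bsub>PSh U C\<^esub> h = g \<cdot>\<^bsub>PSh U C\<^esub> k \<longrightarrow>
      (\<exists>!u. u \<in> hom (PSh U C) Q (msrc p) \<and> p \<cdot>\<^bsub>PSh U C\<^esub> u = h \<and> q \<cdot>\<^bsub>PSh U C\<^esub> u = k)"
      using pb unfolding is_pullback_def PSh_sel by (elim conjE)
    then show ?thesis using hk that by blast
  qed
  then have u': "is_presheaf_map U C u" "msrc u = P" "mtgt u = msrc p"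
    by (simp_all add: PSh_hom)
  show ?thesis
  proof (rule that)
    show "app u c w \<in> sec (msrc p) c"
      using is_presheaf_mapD(5)[OF u'(1) c] u' w by simp
    show "app p c (app u c w) = x"
      using u w u' c by (metis PSh_comp_app)
    show "app q c (app u c w) = y"
      using u w u' c by (metis PSh_comp_app)
  qed
qed

text \<open>On the union \<open>B\<close> of the images, the map takes the value at any chosen
  preimage; \<open>compatible\<close> makes this independent of the index and of the preimage, and
  its case \<open>i = k\<close> covers pieces not known to be injective. The inclusion is delivered
  as a map as well, since stability of \<open>B\<close> under restriction comes out of the same
  computation.\<close>

lemma glue:
  assumes s: "\<And>i. s i \<in> hom (PSh U C) (X i) Z" and t: "\<And>i. t i \<in> hom (PSh U C) (X i) A"
    and Z: "is_presheaf U C Z" and A: "is_presheaf U C A"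
    and compatible: "\<And>i k c x y. c \<in> Obj C \<Longrightarrow> x \<in> sec (X i) c \<Longrightarrow> y \<in> sec (X k) c \<Longrightarrow>
      app (s i) c x = app (s k) c y \<Longrightarrow> app (t i) c x = app (t k) c y"
    and B: "\<And>c. c \<in> Obj C \<Longrightarrow> B c = (\<Union>i. map_image (s i) c)"
  obtains \<psi> where "inclusion C Z B \<in> hom (PSh U C) (subpresheaf C Z B) Z"
    "\<psi> \<in> hom (PSh U C) (subpresheaf C Z B) A"
    "\<And>i c x. c \<in> Obj C \<Longrightarrow> x \<in> sec (X i) c \<Longrightarrow> app \<psi> c (app (s i) c x) = app (t i) c x"
    "\<And>i c x. c \<in> Obj C \<Longrightarrow> x \<in> sec (X i) c \<Longrightarrow> app (s i) c x \<in> B c"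
proof -
  have s': "is_presheaf_map U C (s i)" "msrc (s i) = X i" "mtgt (s i) = Z"
    and t': "is_presheaf_map U C (t i)" "msrc (t i) = X i" "mtgt (t i) = A" for i
    using s t by (simp_all add: PSh_hom)
  note sD = is_presheaf_mapD[OF s'(1), unfolded s'] and tD = is_presheaf_mapD[OF t'(1), unfolded t']
  define \<phi> where "\<phi> c z = (SOME a. \<exists>i. \<exists>x\<in>sec (X i) c. app (s i) c x = z \<and> a = app (t i) c x)" for c z
  have \<phi>: "\<phi> c (app (s i) c x) = app (t i) c x" if "c \<in> Obj C" "x \<in> sec (X i) c" for i c x
    unfolding \<phi>_def
  proof (rule some_equality)
    show "\<exists>k. \<exists>y\<in>sec (X k) c. app (s k) c y = app (s i) c x \<and> app (t i) c x = app (t k) c y"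
      using that by blast
    show "a = app (t i) c x"
      if "\<exists>k. \<exists>y\<in>sec (X k) c. app (s k) c y = app (s i) c x \<and> a = app (t k) c y" for a
      using that compatible[OF \<open>c \<in> Obj C\<close> _ \<open>x \<in> sec (X i) c\<close>] by blast
  qed
  have mem: "app (s i) c x \<in> B c" if "c \<in> Obj C" "x \<in> sec (X i) c" for i c x
    using that B s' by (auto simp: map_image_def)
  have memE: "\<exists>i. \<exists>x\<in>sec (X i) c. z = app (s i) c x" if "c \<in> Obj C" "z \<in> B c" for c z
    using that B s' by (auto simp: map_image_def)
  have sub: "B c \<subseteq> sec Z c" if "c \<in> Obj C" for c
    using memE[OF that] sD(5)[OF that] by blast
  have res_mem: "res Z a z \<in> B (src C a) \<and> \<phi> (src C a) (res Z a z) = res A a (\<phi> (tgt C a) z)"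
    if a: "a \<in> Arr C" and z: "z \<in> B (tgt C a)" for a z
  proof -
    obtain i x where x: "x \<in> sec (X i) (tgt C a)" "z = app (s i) (tgt C a) x"
      using memE[OF C.tgt_obj[OF a] z] by blast
    have "res Z a z = app (s i) (src C a) (res (X i) a x)"
      using sD(6)[OF a x(1)] x by simp
    moreover have "res (X i) a x \<in> sec (X i) (src C a)"
      using is_presheafD(5)[OF sD(1)] a x by blast
    ultimately show ?thesis
      using \<phi> mem C.src_obj[OF a] C.tgt_obj[OF a] tD(6)[OF a x(1)] x by simp
  qed
  have stable: "res Z a z \<in> B (src C a)" if "a \<in> Arr C" "z \<in> B (tgt C a)" for a z
    using res_mem that by blast
  have inc: "is_presheaf_map U C (inclusion C Z B)"
    by (rule is_presheaf_map_inclusion[OF C_category set_universe_axioms Z sub stable])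
  define \<psi> where "\<psi> = mk_map C (subpresheaf C Z B) A \<phi>"
  have "is_presheaf_map U C \<psi>"
    unfolding \<psi>_def
  proof (rule is_presheaf_map_mk_map[OF C_category _ A])
    show "is_presheaf U C (subpresheaf C Z B)"
      using is_presheaf_mapD(1)[OF inc] by (simp add: inclusion_def)
    show "\<phi> c z \<in> sec A c" if "c \<in> Obj C" "z \<in> sec (subpresheaf C Z B) c" for c z
      using memE[OF that(1)] that \<phi> tD(5) by (fastforce simp: subpresheaf_def)
    show "\<phi> (src C a) (res (subpresheaf C Z B) a z) = res A a (\<phi> (tgt C a) z)"
      if "a \<in> Arr C" "z \<in> sec (subpresheaf C Z B) (tgt C a)" for a z
      using that res_mem[OF that(1)] C.tgt_obj[OF that(1)] by (simp add: subpresheaf_def)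
  qed
  then show ?thesis
    using that[of \<psi>] inc \<phi> mem by (simp add: PSh_hom inclusion_def \<psi>_def subpresheaf_def)
qed

text \<open>The constant presheaf at a one-element set is terminal. Existence gives meaning to
  \<open>to_terminal\<close>, which selects a terminal object by choice.\<close>

lemma terminal_exists: "\<exists>E. is_terminal (PSh U C) E"
proof -
  define u0 :: 'u where "u0 = undefined"
  define E where "E = mk_presheaf C (\<lambda>c. {u0}) (\<lambda>a x. x)"
  have E: "is_presheaf U C E"
    unfolding E_def by (rule is_presheaf_mk_presheaf[OF C_category]) (auto simp: finite_mem)
  have "\<exists>!f. f \<in> hom (PSh U C) X E" if X: "is_presheaf U C X" for X
  proof
    show "mk_map C X E (\<lambda>c x. u0) \<in> hom (PSh U C) X E"
      unfolding PSh_hom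
      using is_presheaf_map_mk_map[OF C_category X E, of "\<lambda>c x. u0"] C.src_obj C.tgt_obj
      by (simp add: E_def)
    show "f = mk_map C X E (\<lambda>c x. u0)" if "f \<in> hom (PSh U C) X E" for f
    proof (rule presheaf_map_eqI[of U C])
      show "is_presheaf_map U C (mk_map C X E (\<lambda>c x. u0))"
        using \<open>mk_map C X E (\<lambda>c x. u0) \<in> hom (PSh U C) X E\<close> by (simp add: PSh_hom)
      show "app f c x = app (mk_map C X E (\<lambda>c x. u0)) c x" if "c \<in> Obj C" "x \<in> sec (msrc f) c" for c x
        using that \<open>f \<in> hom (PSh U C) X E\<close> is_presheaf_mapD(5)[of U C f c x]
        by (auto simp: PSh_hom E_def)
    qed (use that in \<open>auto simp: PSh_hom\<close>)
  qed
  then show ?thesis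
    using E unfolding is_terminal_def by auto
qed

text \<open>Sections of the coproduct are disjoint unions, tagged by distinct elements
  \<open>l\<close> and \<open>r\<close> and coded in \<open>'u\<close>. As \<open>copair\<close>
  selects an arbitrary coproduct, one must exist; disjointness in this explicit one is transferred
  to all others in \<open>coproduct_sections\<close>.\<close>

lemma coproduct_exists:
  assumes X: "is_presheaf U C X" and Y: "is_presheaf U C Y"
  obtains P i j where "is_coproduct (PSh U C) X Y (P, i, j)"
    "\<And>c x y. c \<in> Obj C \<Longrightarrow> x \<in> sec X c \<Longrightarrow> y \<in> sec Y c \<Longrightarrow> app i c x \<noteq> app j c y"
proof -
  obtain code :: "'u \<times> 'u \<Rightarrow> 'u" where inj: "inj code"
    using pairing by blast
  define dec where "dec = inv code"
  have [simp]: "dec (code z) = z" for z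
    using inj by (simp add: dec_def)
  obtain A :: "'u set" where "card A = 2"
    using infinite_set infinite_arbitrarily_large by metis
  then obtain l r :: 'u where lr [simp]: "l \<noteq> r" "r \<noteq> l"
    by (metis card_2_iff)
  define S where "S c = code ` ({l} \<times> sec X c \<union> {r} \<times> sec Y c)" for c
  define R where "R a z = code (fst (dec z), res (if fst (dec z) = l then X else Y) a (snd (dec z)))" for a z
  define P where "P = mk_presheaf C S R"
  note XD = is_presheafD[OF X] and YD = is_presheafD[OF Y]
  have P: "is_presheaf U C P"
    unfolding P_def
  proof (rule is_presheaf_mk_presheaf[OF C_category])
    show "S c \<in> U" if c: "c \<in> Obj C" for c
    proof -
      \<comment> \<open>The axioms of the universe provide indexed unions, so the two summands are
        indexed by their tags.\<close>
      have "(\<Union>z\<in>{l, r}. code ` ({z} \<times> (if z = l then sec X c else sec Y c))) \<in> U"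
        by (intro union image_Times) (use XD(3)[OF c] YD(3)[OF c] in \<open>auto simp: finite_mem\<close>)
      then show ?thesis by (simp add: S_def image_Un)
    qed
  qed (use XD(5-7) YD(5-7) in \<open>auto simp: S_def R_def intro!: imageI\<close>)
  define i where "i = mk_map C X P (\<lambda>c x. code (l, x))"
  define j where "j = mk_map C Y P (\<lambda>c y. code (r, y))"
  have i: "is_presheaf_map U C i"
    unfolding i_def
    by (rule is_presheaf_map_mk_map[OF C_category X P])
      (use C.src_obj C.tgt_obj in \<open>auto simp: P_def S_def R_def\<close>)
  have j: "is_presheaf_map U C j"
    unfolding j_def
    by (rule is_presheaf_map_mk_map[OF C_category Y P])
      (use C.src_obj C.tgt_obj in \<open>auto simp: P_def S_def R_def\<close>)
  have "is_coproduct (PSh U C) X Y (P, i, j)"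
    unfolding is_coproduct_def split_conv
  proof (intro conjI allI ballI)
    show "i \<in> hom (PSh U C) X P" "j \<in> hom (PSh U C) Y P"
      using i j by (simp_all add: PSh_hom i_def j_def)
    fix Q f g
    assume f: "f \<in> hom (PSh U C) X Q" and g: "g \<in> hom (PSh U C) Y Q"
    then have f': "is_presheaf_map U C f" "msrc f = X" "mtgt f = Q"
      and g': "is_presheaf_map U C g" "msrc g = Y" "mtgt g = Q"
      by (simp_all add: PSh_hom)
    note fD = is_presheaf_mapD[OF f'(1), unfolded f'] and gD = is_presheaf_mapD[OF g'(1), unfolded g']
    define u where "u = mk_map C P Q (\<lambda>c z. if fst (dec z) = l then app f c (snd (dec z)) else app g c (snd (dec z)))"
    have u: "is_presheaf_map U C u"
      unfolding u_def
      by (rule is_presheaf_map_mk_map[OF C_category P fD(2)])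
        (use C.src_obj C.tgt_obj fD(5,6) gD(5,6) in \<open>auto simp: P_def S_def R_def\<close>)
    show "\<exists>!u. u \<in> hom (PSh U C) P Q \<and> u \<cdot>\<^bsub>PSh U C\<^esub> i = f \<and> u \<cdot>\<^bsub>PSh U C\<^esub> j = g"
    proof (rule ex1I[of _ u])
      have "u \<cdot>\<^bsub>PSh U C\<^esub> i = f" "u \<cdot>\<^bsub>PSh U C\<^esub> j = g"
        by (rule presheaf_map_eqI[of U C];
            use f' g' u i j comp_map in \<open>auto simp: u_def i_def j_def P_def S_def\<close>)+
      then show "u \<in> hom (PSh U C) P Q \<and> u \<cdot>\<^bsub>PSh U C\<^esub> i = f \<and> u \<cdot>\<^bsub>PSh U C\<^esub> j = g"
        using u by (simp add: PSh_hom u_def)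
      fix v assume v: "v \<in> hom (PSh U C) P Q \<and> v \<cdot>\<^bsub>PSh U C\<^esub> i = f \<and> v \<cdot>\<^bsub>PSh U C\<^esub> j = g"
      have vi: "app v c (code (l, x)) = app f c x" if "c \<in> Obj C" "x \<in> sec X c" for c x
        using that v PSh_comp_app[of c C x i U v] by (simp add: i_def)
      have vj: "app v c (code (r, x)) = app g c x" if "c \<in> Obj C" "x \<in> sec Y c" for c x
        using that v PSh_comp_app[of c C x j U v] by (simp add: j_def)
      show "v = u"
      proof (rule presheaf_map_eqI[of U C])
        show "app v c z = app u c z" if "c \<in> Obj C" "z \<in> sec (msrc v) c" for c z
          using that v vi vj by (auto simp: u_def P_def S_def PSh_hom)
      qed (use u v in \<open>auto simp: PSh_hom u_def\<close>)
    qed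
  qed
  moreover have "app i c x \<noteq> app j c y" if "c \<in> Obj C" "x \<in> sec X c" "y \<in> sec Y c" for c x y
    using that inj by (simp add: i_def j_def inj_eq)
  ultimately show ?thesis using that by blast
qed

text \<open>For disjointness, a common value would stay common under the comparison map to the
  explicit coproduct, whose summands are disjoint. For covering, both injections factor through the
  union \<open>B\<close> of their images, and uniqueness in the universal property makes the
  composite of \<open>u\<close> with the inclusion of \<open>B\<close> the identity.\<close>

lemma coproduct_sections:
  assumes P: "is_coproduct (PSh U C) X Y (P, i, j)"
    and X: "is_presheaf U C X" and Y: "is_presheaf U C Y" and c: "c \<in> Obj C"
  shows "sec P c = map_image i c \<union> map_image j c"
    and "x \<in> sec X c \<Longrightarrow> y \<in> sec Y c \<Longrightarrow> app i c x \<noteq> app j c y"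
proof -
  have ij: "i \<in> hom (PSh U C) X P" "j \<in> hom (PSh U C) Y P"
    and univ: "\<And>Q f g. f \<in> hom (PSh U C) X Q \<Longrightarrow> g \<in> hom (PSh U C) Y Q \<Longrightarrow>
      \<exists>!u. u \<in> hom (PSh U C) P Q \<and> u \<cdot>\<^bsub>PSh U C\<^esub> i = f \<and> u \<cdot>\<^bsub>PSh U C\<^esub> j = g"
    using P by (auto simp: is_coproduct_def)
  then have i': "is_presheaf_map U C i" "msrc i = X" "mtgt i = P"
    and j': "is_presheaf_map U C j" "msrc j = Y" "mtgt j = P"
    by (simp_all add: PSh_hom)
  note iD = is_presheaf_mapD[OF i'(1), unfolded i'] and jD = is_presheaf_mapD[OF j'(1), unfolded j']
  show "app i c x \<noteq> app j c y" if xy: "x \<in> sec X c" "y \<in> sec Y c"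
  proof
    assume eq: "app i c x = app j c y"
    obtain Q f g where Q: "is_coproduct (PSh U C) X Y (Q, f, g)"
      and ne: "\<And>c x y. c \<in> Obj C \<Longrightarrow> x \<in> sec X c \<Longrightarrow> y \<in> sec Y c \<Longrightarrow> app f c x \<noteq> app g c y"
      using coproduct_exists[OF X Y] by blast
    have "f \<in> hom (PSh U C) X Q" "g \<in> hom (PSh U C) Y Q"
      using Q by (auto simp: is_coproduct_def)
    then obtain u where "u \<cdot>\<^bsub>PSh U C\<^esub> i = f" "u \<cdot>\<^bsub>PSh U C\<^esub> j = g"
      using univ by blast
    then have "app f c x = app g c y"
      using eq xy c i' j' by (metis PSh_comp_app)
    then show False using ne c xy by blast
  qed
  define B where "B c = map_image i c \<union> map_image j c" for c
  have sub: "B c \<subseteq> sec P c" if "c \<in> Obj C" for c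
    using iD(5)[OF that] jD(5)[OF that] by (auto simp: B_def map_image_def i' j')
  have stable: "res P a z \<in> B (src C a)" if a: "a \<in> Arr C" "z \<in> B (tgt C a)" for a z
    using that(2) iD(6)[OF a(1), symmetric] jD(6)[OF a(1), symmetric]
      is_presheafD(5)[OF X a(1)] is_presheafD(5)[OF Y a(1)]
    by (auto simp: B_def map_image_def i' j')
  note inc = is_presheaf_map_inclusion[OF C_category set_universe_axioms iD(2) sub stable]
  define Q where "Q = subpresheaf C P B"
  have Q: "is_presheaf U C Q"
    using is_presheaf_mapD(1)[OF inc] by (simp add: inclusion_def Q_def)
  have inc': "inclusion C P B \<in> hom (PSh U C) Q P"
    using inc by (simp add: PSh_hom inclusion_def Q_def)
  define i1 where "i1 = mk_map C X Q (app i)"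
  define j1 where "j1 = mk_map C Y Q (app j)"
  have i1: "i1 \<in> hom (PSh U C) X Q" and j1: "j1 \<in> hom (PSh U C) Y Q"
    unfolding i1_def j1_def PSh_hom
    by (intro conjI is_presheaf_map_mk_map[OF C_category _ Q];
        use X Y iD(6) jD(6) C.tgt_obj in \<open>auto simp: Q_def subpresheaf_def B_def map_image_def i' j'\<close>)+
  obtain u where u: "u \<in> hom (PSh U C) P Q" "u \<cdot>\<^bsub>PSh U C\<^esub> i = i1" "u \<cdot>\<^bsub>PSh U C\<^esub> j = j1"
    using univ[OF i1 j1] by blast
  have "inclusion C P B \<cdot>\<^bsub>PSh U C\<^esub> i1 = i"
    using PSh.comp_hom[OF i1 inc'] i' iD(5)
    by (intro presheaf_map_eqI[of U C])
      (auto simp: PSh_hom i1_def inclusion_def B_def map_image_def)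
  moreover have "inclusion C P B \<cdot>\<^bsub>PSh U C\<^esub> j1 = j"
    using PSh.comp_hom[OF j1 inc'] j' jD(5)
    by (intro presheaf_map_eqI[of U C])
      (auto simp: PSh_hom j1_def inclusion_def B_def map_image_def)
  ultimately have "(inclusion C P B \<cdot>\<^bsub>PSh U C\<^esub> u) \<cdot>\<^bsub>PSh U C\<^esub> i = i" "(inclusion C P B \<cdot>\<^bsub>PSh U C\<^esub> u) \<cdot>\<^bsub>PSh U C\<^esub> j = j"
    using PSh.comp_assoc[OF ij(1) u(1) inc'] PSh.comp_assoc[OF ij(2) u(1) inc'] u by simp_all
  moreover have P': "P \<in> Obj (PSh U C)" using iD(2) by simp
  ultimately have one: "inclusion C P B \<cdot>\<^bsub>PSh U C\<^esub> u = one (PSh U C) P"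
    using univ[OF ij] PSh.comp_hom[OF u(1) inc'] PSh.one_hom[OF P'] PSh.one_comp[OF ij(1)] PSh.one_comp[OF ij(2)]
    by metis
  have u': "is_presheaf_map U C u" "msrc u = P" "mtgt u = Q"
    using u(1) by (simp_all add: PSh_hom)
  have "z \<in> B c" if "z \<in> sec P c" for z
  proof -
    have uz: "app u c z \<in> B c"
      using is_presheaf_mapD(5)[OF u'(1) c] u' that c by (simp add: Q_def subpresheaf_def)
    have "z = app (inclusion C P B \<cdot>\<^bsub>PSh U C\<^esub> u) c z"
      using one that c by simp
    also have "\<dots> = app u c z"
      using that c u' uz by (simp add: inclusion_def)
    finally show ?thesis using uz by simp
  qed
  then show "sec P c = map_image i c \<union> map_image j c"
    using sub[OF c] by (auto simp: B_def)
qed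

text \<open>Whichever coproduct \<open>copair\<close> selects, its sections are covered by two
  disjoint summands, and a monic copairing, being injective on sections, keeps them disjoint. This
  is the form in which the monicity axiom of a cylinder is used.\<close>

lemma copair_sections:
  assumes f: "f \<in> hom (PSh U C) X Z" and g: "g \<in> hom (PSh U C) Y Z" and c: "c \<in> Obj C"
  shows "map_image (copair (PSh U C) f g) c = map_image f c \<union> map_image g c"
    and "monic (PSh U C) (copair (PSh U C) f g) \<Longrightarrow> x \<in> sec X c \<Longrightarrow> y \<in> sec Y c \<Longrightarrow>
      app f c x \<noteq> app g c y"
proof -
  have X: "is_presheaf U C X" and Y: "is_presheaf U C Y"
    using PSh.hom_Obj[OF f] PSh.hom_Obj[OF g] by simp_all
  define s where "s = (SOME s. is_coproduct (PSh U C) X Y s)"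
  have s: "is_coproduct (PSh U C) X Y s"
    unfolding s_def by (rule someI_ex) (metis coproduct_exists[OF X Y])
  obtain P i j where sP: "s = (P, i, j)"
    by (cases s)
  note P = s[unfolded sP]
  define u where "u = copair (PSh U C) f g"
  have ij: "i \<in> hom (PSh U C) X P" "j \<in> hom (PSh U C) Y P"
    and "\<exists>!u. u \<in> hom (PSh U C) P Z \<and> u \<cdot>\<^bsub>PSh U C\<^esub> i = f \<and> u \<cdot>\<^bsub>PSh U C\<^esub> j = g"
    using P f g by (auto simp: is_coproduct_def)
  moreover have "u = (THE u. u \<in> hom (PSh U C) P Z \<and> u \<cdot>\<^bsub>PSh U C\<^esub> i = f \<and> u \<cdot>\<^bsub>PSh U C\<^esub> j = g)"
    using sP f g unfolding u_def copair_def s_def by (simp add: PSh_hom)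
  ultimately have u: "u \<in> hom (PSh U C) P Z" "u \<cdot>\<^bsub>PSh U C\<^esub> i = f" "u \<cdot>\<^bsub>PSh U C\<^esub> j = g"
    by (metis (mono_tags, lifting) theI')+
  have ui: "app u c (app i c x) = app f c x" if "x \<in> sec X c" for x
    using that u c ij by (auto simp: PSh_hom)
  have uj: "app u c (app j c x) = app g c x" if "x \<in> sec Y c" for x
    using that u c ij by (auto simp: PSh_hom)
  have sel: "msrc f = X" "msrc g = Y" "msrc i = X" "msrc j = Y" "msrc u = P"
    using f g ij u(1) by (simp_all add: PSh_hom)
  have "map_image u c = app u c ` (map_image i c \<union> map_image j c)"
    unfolding coproduct_sections(1)[OF P X Y c, symmetric] by (simp add: map_image_def sel)
  also have "\<dots> = map_image f c \<union> map_image g c"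
    using ui uj by (auto simp: map_image_def sel image_Un image_image)
  finally show "map_image (copair (PSh U C) f g) c = map_image f c \<union> map_image g c"
    by (simp add: u_def)
  assume m: "monic (PSh U C) (copair (PSh U C) f g)" and xy: "x \<in> sec X c" "y \<in> sec Y c"
  have "app i c x \<in> sec P c" "app j c y \<in> sec P c"
    using xy coproduct_sections(1)[OF P X Y c] by (auto simp: map_image_def sel)
  then show "app f c x \<noteq> app g c y"
    using monic_inj[OF m c, folded u_def] coproduct_sections(2)[OF P X Y c] xy ui uj sel by metis
qed

end

section \<open>Homotopy classes\<close>

locale cylinders = category D for D :: "('a, 'b) category" +
  fixes I :: "('a, 'b) cylinder_func"
  assumes functorial: "functorial_cylinder D I"
begin

abbreviation end_map :: "bool \<Rightarrow> 'a \<Rightarrow> 'b" where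
  "end_map e X \<equiv> face (fobj I X) e"

lemma cylinder: "X \<in> Obj D \<Longrightarrow> is_cylinder D (fobj I X)" and base: "X \<in> Obj D \<Longrightarrow> base (fobj I X) = X"
  using functorial by (auto simp: functorial_cylinder_def is_functor_def cylinder_cat_def)

lemma end_hom: "X \<in> Obj D \<Longrightarrow> end_map e X \<in> hom D X (fobj (tensor I) X)"
  using cylinder[of X] base[of X] by (simp add: is_cylinder_def tensor_def)

lemma proj_hom: "X \<in> Obj D \<Longrightarrow> proj (fobj I X) \<in> hom D (fobj (tensor I) X) X"
  using cylinder[of X] base[of X] by (simp add: is_cylinder_def tensor_def)

lemma proj_end: "X \<in> Obj D \<Longrightarrow> proj (fobj I X) \<cdot>\<^bsub>D\<^esub> end_map e X = one D X"
  using cylinder[of X] base[of X] by (simp add: is_cylinder_def)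

lemma cylinder_map:
  assumes "f \<in> hom D X Y"
  shows "is_cylinder_map D (farr I f)" "csrc (farr I f) = fobj I X" "ctgt (farr I f) = fobj I Y"
    "on_base (farr I f) = f"
proof -
  have "is_functor D (cylinder_cat D) I"
    using functorial by (simp add: functorial_cylinder_def)
  from functor_hom[OF this assms] show "is_cylinder_map D (farr I f)"
    "csrc (farr I f) = fobj I X" "ctgt (farr I f) = fobj I Y"
    by (auto simp: hom_def cylinder_cat_def)
  show "on_base (farr I f) = f"
    using functorial homD(1)[OF assms] by (simp add: functorial_cylinder_def)
qed

lemma end_natural:
  assumes "f \<in> hom D X Y"
  shows "end_map e Y \<cdot>\<^bsub>D\<^esub> f = farr (tensor I) f \<cdot>\<^bsub>D\<^esub> end_map e X"
  using cylinder_map[OF assms] by (auto simp: is_cylinder_map_def tensor_def)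

lemma tensor_functor: "is_functor D D (tensor I)"
proof -
  have I: "is_functor D (cylinder_cat D) I"
    using functorial by (simp add: functorial_cylinder_def)
  have "farr (tensor I) f \<in> hom D (fobj (tensor I) X) (fobj (tensor I) Y)" if "f \<in> hom D X Y" for f X Y
    using cylinder_map[OF that] by (auto simp: is_cylinder_map_def tensor_def)
  then have "farr (tensor I) f \<in> hom D (fobj (tensor I) (src D f)) (fobj (tensor I) (tgt D f))"
    if "f \<in> Arr D" for f
    using Arr_hom[OF that] by blast
  moreover have "fobj (tensor I) X \<in> Obj D" "farr (tensor I) (one D X) = one D (fobj (tensor I) X)"
    if "X \<in> Obj D" for X
    using functor_one[OF I that] hom_Obj(2)[OF end_hom[OF that]]
    by (auto simp: tensor_def cylinder_cat_def)
  moreover have "farr (tensor I) (g \<cdot>\<^bsub>D\<^esub> f) = farr (tensor I) g \<cdot>\<^bsub>D\<^esub> farr (tensor I) f"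
    if "f \<in> Arr D" "g \<in> Arr D" "tgt D f = src D g" for f g
    using I that by (simp add: tensor_def cylinder_cat_def is_functor_def)
  ultimately show ?thesis
    unfolding is_functor_def by blast
qed

section \<open>Operations on homotopies and the equivalence relation they generate\<close>

lemma homotopicI:
  assumes "\<theta> \<in> hom D (fobj (tensor I) X) Y" "X \<in> Obj D"
    "\<theta> \<cdot>\<^bsub>D\<^esub> end_map False X = f" "\<theta> \<cdot>\<^bsub>D\<^esub> end_map True X = g"
  shows "(f, g) \<in> homotopic D I X Y"
  using assms comp_hom[OF end_hom[OF assms(2)] assms(1)] by (auto simp: homotopic_def)

lemma homotopicE:
  assumes "(f, g) \<in> homotopic D I X Y"
  obtains \<theta> where "f \<in> hom D X Y" "g \<in> hom D X Y" "X \<in> Obj D"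
    "\<theta> \<in> hom D (fobj (tensor I) X) Y"
    "\<theta> \<cdot>\<^bsub>D\<^esub> end_map False X = f" "\<theta> \<cdot>\<^bsub>D\<^esub> end_map True X = g"
  using assms hom_Obj unfolding homotopic_def by blast

text \<open>The constant homotopy is \<open>f\<close> composed with the projection of the
  cylinder.\<close>

lemma homotopic_refl:
  assumes f: "f \<in> hom D X Y"
  shows "(f, f) \<in> homotopic D I X Y"
proof -
  note X = hom_Obj(1)[OF f]
  have "(f \<cdot>\<^bsub>D\<^esub> proj (fobj I X)) \<cdot>\<^bsub>D\<^esub> end_map e X = f" for e
    using comp_assoc[OF end_hom[OF X] proj_hom[OF X] f] proj_end[OF X] comp_one[OF f] by metis
  then show ?thesis
    using homotopicI[OF comp_hom[OF proj_hom[OF X] f] X] by blast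
qed

lemma homotopic_postcomp:
  assumes fg: "(f, g) \<in> homotopic D I X Y" and h: "h \<in> hom D Y Z"
  shows "(h \<cdot>\<^bsub>D\<^esub> f, h \<cdot>\<^bsub>D\<^esub> g) \<in> homotopic D I X Z"
proof -
  obtain \<theta> where X: "X \<in> Obj D" and \<theta>: "\<theta> \<in> hom D (fobj (tensor I) X) Y"
    "\<theta> \<cdot>\<^bsub>D\<^esub> end_map False X = f" "\<theta> \<cdot>\<^bsub>D\<^esub> end_map True X = g"
    using fg by (rule homotopicE)
  show ?thesis
    by (rule homotopicI[OF comp_hom[OF \<theta>(1) h] X];
        use comp_assoc[OF end_hom[OF X] \<theta>(1) h] \<theta> in metis)
qed

text \<open>The homotopy is composed with the tensor of \<open>h\<close>, and naturality of the end
  maps identifies the new ends.\<close>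

lemma homotopic_precomp:
  assumes fg: "(f, g) \<in> homotopic D I X Y" and h: "h \<in> hom D W X"
  shows "(f \<cdot>\<^bsub>D\<^esub> h, g \<cdot>\<^bsub>D\<^esub> h) \<in> homotopic D I W Y"
proof -
  obtain \<theta> where X: "X \<in> Obj D" and \<theta>: "\<theta> \<in> hom D (fobj (tensor I) X) Y"
    "\<theta> \<cdot>\<^bsub>D\<^esub> end_map False X = f" "\<theta> \<cdot>\<^bsub>D\<^esub> end_map True X = g"
    using fg by (rule homotopicE)
  note W = hom_Obj(1)[OF h] and Th = functor_hom[OF tensor_functor h]
  have "(\<theta> \<cdot>\<^bsub>D\<^esub> farr (tensor I) h) \<cdot>\<^bsub>D\<^esub> end_map e W = (\<theta> \<cdot>\<^bsub>D\<^esub> end_map e X) \<cdot>\<^bsub>D\<^esub> h" for e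
    using comp_assoc[OF end_hom[OF W] Th \<theta>(1)] comp_assoc[OF h end_hom[OF X] \<theta>(1)] end_natural[OF h]
    by metis
  then show ?thesis
    using homotopicI[OF comp_hom[OF Th \<theta>(1)] W] \<theta> by metis
qed

lemma equiv_homotopic_eq: "equiv (hom D X Y) (homotopic_eq D I X Y)"
proof (rule equivI)
  have "sym ((homotopic D I X Y \<union> (homotopic D I X Y)\<inverse>)\<^sup>*)"
    by (intro sym_rtrancl sym_Un_converse)
  then show "sym (homotopic_eq D I X Y)"
    unfolding homotopic_eq_def sym_def by blast
  show "trans (homotopic_eq D I X Y)"
    unfolding homotopic_eq_def trans_def by (auto intro: rtrancl_trans)
qed (auto simp: homotopic_eq_def refl_on_def)

lemma homotopic_imp_eq:
  assumes "(f, g) \<in> homotopic D I X Y"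
  shows "(f, g) \<in> homotopic_eq D I X Y" "(g, f) \<in> homotopic_eq D I X Y"
  using assms by (auto simp: homotopic_eq_def homotopic_def)

lemma rtrancl_image:
  assumes "\<And>x y. (x, y) \<in> R \<Longrightarrow> (f x, f y) \<in> S" "(x, y) \<in> R\<^sup>*"
  shows "(f x, f y) \<in> S\<^sup>*"
  using assms(2) by induction (auto intro: rtrancl_into_rtrancl assms(1))

lemma homotopic_eq_postcomp:
  assumes "(f, g) \<in> homotopic_eq D I X Y" and h: "h \<in> hom D Y Z"
  shows "(h \<cdot>\<^bsub>D\<^esub> f, h \<cdot>\<^bsub>D\<^esub> g) \<in> homotopic_eq D I X Z"
proof -
  let ?R = "\<lambda>X Y. homotopic D I X Y \<union> (homotopic D I X Y)\<inverse>"
  have "(f, g) \<in> (?R X Y)\<^sup>*" "f \<in> hom D X Y" "g \<in> hom D X Y"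
    using assms by (auto simp: homotopic_eq_def)
  moreover from this(1) have "(h \<cdot>\<^bsub>D\<^esub> f, h \<cdot>\<^bsub>D\<^esub> g) \<in> (?R X Z)\<^sup>*"
    by (rule rtrancl_image[rotated]) (use homotopic_postcomp[OF _ h] in blast)
  ultimately show ?thesis
    using comp_hom[OF _ h] by (simp add: homotopic_eq_def)
qed

lemma homotopic_eq_precomp:
  assumes "(f, g) \<in> homotopic_eq D I X Y" and h: "h \<in> hom D W X"
  shows "(f \<cdot>\<^bsub>D\<^esub> h, g \<cdot>\<^bsub>D\<^esub> h) \<in> homotopic_eq D I W Y"
proof -
  let ?R = "\<lambda>X Y. homotopic D I X Y \<union> (homotopic D I X Y)\<inverse>"
  have "(f, g) \<in> (?R X Y)\<^sup>*" "f \<in> hom D X Y" "g \<in> hom D X Y"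
    using assms by (auto simp: homotopic_eq_def)
  moreover from this(1) have "(f \<cdot>\<^bsub>D\<^esub> h, g \<cdot>\<^bsub>D\<^esub> h) \<in> (?R W Y)\<^sup>*"
    by (rule rtrancl_image[rotated]) (use homotopic_precomp[OF _ h] in blast)
  ultimately show ?thesis
    using comp_hom[OF h] by (simp add: homotopic_eq_def)
qed

text \<open>Surjectivity of [f, A], and in \<open>class_inj\<close> its injectivity, are put on
  representatives, so that only \<open>precomp_class_bij\<close> has to handle quotient
  sets.\<close>

definition class_surj :: "'a \<Rightarrow> 'b \<Rightarrow> bool" where
  "class_surj A f \<longleftrightarrow> (\<forall>h\<in>hom D (src D f) A. \<exists>g\<in>hom D (tgt D f) A.
    (g \<cdot>\<^bsub>D\<^esub> f, h) \<in> homotopic_eq D I (src D f) A)"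

definition class_inj :: "'a \<Rightarrow> 'b \<Rightarrow> bool" where
  "class_inj A f \<longleftrightarrow> (\<forall>g\<in>hom D (tgt D f) A. \<forall>h\<in>hom D (tgt D f) A.
    (g \<cdot>\<^bsub>D\<^esub> f, h \<cdot>\<^bsub>D\<^esub> f) \<in> homotopic_eq D I (src D f) A \<longrightarrow>
    (g, h) \<in> homotopic_eq D I (tgt D f) A)"

lemma class_surjE:
  assumes "class_surj A f" "f \<in> hom D X Y" "h \<in> hom D X A"
  obtains g where "g \<in> hom D Y A" "(g \<cdot>\<^bsub>D\<^esub> f, h) \<in> homotopic_eq D I X A"
  using assms by (auto simp: class_surj_def homD)

lemma class_injD:
  assumes "class_inj A f" "f \<in> hom D X Y" "g \<in> hom D Y A" "h \<in> hom D Y A"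
    "(g \<cdot>\<^bsub>D\<^esub> f, h \<cdot>\<^bsub>D\<^esub> f) \<in> homotopic_eq D I X A"
  shows "(g, h) \<in> homotopic_eq D I Y A"
  using assms by (auto simp: class_inj_def homD)

lemma precomp_class_bij:
  assumes f: "f \<in> hom D X Y"
    and bij: "bij_betw (precomp_class D I f A) (homotopy_classes D I Y A) (homotopy_classes D I X A)"
  shows "class_surj A f" "class_inj A f"
proof -
  note eqX = equiv_homotopic_eq[of X A] and eqY = equiv_homotopic_eq[of Y A]
  \<comment> \<open>The composites of \<open>f\<close> with the members of a class need not fill a
    class; the relational image in \<open>precomp_class\<close> completes them to the class of the
    composite of \<open>g\<close> and \<open>f\<close>.\<close>
  have pc: "precomp_class D I f A (homotopic_eq D I Y A `` {g}) = homotopic_eq D I X A `` {g \<cdot>\<^bsub>D\<^esub> f}"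
    if g: "g \<in> hom D Y A" for g
  proof -
    have "homotopic_eq D I X A `` {g' \<cdot>\<^bsub>D\<^esub> f} = homotopic_eq D I X A `` {g \<cdot>\<^bsub>D\<^esub> f}"
      if "(g, g') \<in> homotopic_eq D I Y A" for g'
      using equiv_class_eq[OF eqX homotopic_eq_precomp[OF that f]] by simp
    moreover have "(g, g) \<in> homotopic_eq D I Y A"
      using equiv_class_self[OF eqY g] by simp
    ultimately show ?thesis
      unfolding precomp_class_def homD(2)[OF f] by blast
  qed
  show "class_inj A f"
    unfolding class_inj_def homD(2,3)[OF f]
  proof (intro ballI impI)
    fix g h assume g: "g \<in> hom D Y A" and h: "h \<in> hom D Y A"
      and "(g \<cdot>\<^bsub>D\<^esub> f, h \<cdot>\<^bsub>D\<^esub> f) \<in> homotopic_eq D I X A"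
    then have "precomp_class D I f A (homotopic_eq D I Y A `` {g}) =
        precomp_class D I f A (homotopic_eq D I Y A `` {h})"
      using equiv_class_eq[OF eqX] by (simp add: pc)
    then have "homotopic_eq D I Y A `` {g} = homotopic_eq D I Y A `` {h}"
      using bij g h quotientI unfolding bij_betw_def homotopy_classes_def by (metis inj_on_def)
    then show "(g, h) \<in> homotopic_eq D I Y A"
      using eq_equiv_class[OF _ eqY h] by blast
  qed
  show "class_surj A f"
    unfolding class_surj_def homD(2,3)[OF f]
  proof
    fix h assume h: "h \<in> hom D X A"
    then have "homotopic_eq D I X A `` {h} \<in> homotopy_classes D I X A"
      by (simp add: homotopy_classes_def quotientI)
    also have "homotopy_classes D I X A = precomp_class D I f A ` homotopy_classes D I Y A"
      using bij by (simp add: bij_betw_def)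
    finally obtain g where g: "g \<in> hom D Y A"
      and "homotopic_eq D I X A `` {h} = precomp_class D I f A (homotopic_eq D I Y A `` {g})"
      by (auto simp: homotopy_classes_def quotient_def)
    then have "(g \<cdot>\<^bsub>D\<^esub> f, h) \<in> homotopic_eq D I X A"
      using eq_equiv_class[OF _ eqX h] pc[OF g] by metis
    with g show "\<exists>g\<in>hom D Y A. (g \<cdot>\<^bsub>D\<^esub> f, h) \<in> homotopic_eq D I X A" by blast
  qed
qed

lemma class_surj_extension:
  assumes j: "j \<in> hom D K L" and ext: "\<And>u. u \<in> hom D K A \<Longrightarrow> \<exists>v\<in>hom D L A. v \<cdot>\<^bsub>D\<^esub> j = u"
  shows "class_surj A j"
  unfolding class_surj_def homD(2,3)[OF j]
  using ext homotopic_imp_eq(1)[OF homotopic_refl] by metis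

lemma class_inj_extension:
  assumes j: "j \<in> hom D K L" and ext: "\<And>u. u \<in> hom D K A \<Longrightarrow> \<exists>v\<in>hom D L A. v \<cdot>\<^bsub>D\<^esub> j = u"
    and hep: "extends_along D (tensor I) UNIV end_map A j"
  shows "class_inj A j"
  unfolding class_inj_def homD(2,3)[OF j]
proof (intro ballI impI)
  have lift: "(g, h) \<in> homotopic D I L A"
    if gh: "(g \<cdot>\<^bsub>D\<^esub> j, h \<cdot>\<^bsub>D\<^esub> j) \<in> homotopic D I K A" and g: "g \<in> hom D L A" and h: "h \<in> hom D L A"
    for g h
  proof -
    obtain \<theta> where \<theta>: "\<theta> \<in> hom D (fobj (tensor I) K) A"
      "\<theta> \<cdot>\<^bsub>D\<^esub> end_map False K = g \<cdot>\<^bsub>D\<^esub> j" "\<theta> \<cdot>\<^bsub>D\<^esub> end_map True K = h \<cdot>\<^bsub>D\<^esub> j"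
      using gh by (rule homotopicE)
    define w where "w e = (if e then h else g)" for e
    have w: "w e \<in> hom D L A" "w e \<cdot>\<^bsub>D\<^esub> j = \<theta> \<cdot>\<^bsub>D\<^esub> end_map e K" for e
      using g h \<theta> by (auto simp: w_def)
    obtain \<Theta> where "\<Theta> \<in> hom D (fobj (tensor I) L) A" "\<And>e. \<Theta> \<cdot>\<^bsub>D\<^esub> end_map e L = w e"
    proof (rule extends_alongE[OF hep j \<theta>(1), of w])
    qed (use w in auto)
    then show ?thesis
      using homotopicI[OF _ hom_Obj(2)[OF j]] by (simp add: w_def)
  qed
  fix g h assume g: "g \<in> hom D L A" and h: "h \<in> hom D L A"
    and gh: "(g \<cdot>\<^bsub>D\<^esub> j, h \<cdot>\<^bsub>D\<^esub> j) \<in> homotopic_eq D I K A"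
  \<comment> \<open>The induction claim covers every \<open>h\<close> extending the endpoint
    \<open>b\<close>, because \<open>ext\<close> gives no control over which extension of an
    intermediate map is obtained.\<close>
  have "\<forall>h\<in>hom D L A. h \<cdot>\<^bsub>D\<^esub> j = b \<longrightarrow> (g, h) \<in> homotopic_eq D I L A"
    if "(g \<cdot>\<^bsub>D\<^esub> j, b) \<in> (homotopic D I K A \<union> (homotopic D I K A)\<inverse>)\<^sup>*" for b
    using that
  proof (induction rule: rtrancl_induct)
    case base
    \<comment> \<open>Two extensions of the same map are homotopic: extend the constant homotopy on
      \<open>K\<close> with these two maps as ends.\<close>
    show ?case
      using homotopic_imp_eq(1)[OF lift] g homotopic_refl[OF comp_hom[OF j]] by metis
  next
    case (step b c)
    then have "b \<in> hom D K A"
      by (auto simp: homotopic_def)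
    then obtain v where v: "v \<in> hom D L A" "v \<cdot>\<^bsub>D\<^esub> j = b"
      using ext by blast
    then have gv: "(g, v) \<in> homotopic_eq D I L A"
      using step.IH by blast
    show ?case
    proof (intro ballI impI)
      fix h assume h: "h \<in> hom D L A" "h \<cdot>\<^bsub>D\<^esub> j = c"
      \<comment> \<open>A link of the chain may point either way, so \<open>lift\<close> is supplied
        in both directions.\<close>
      have "(v, h) \<in> homotopic_eq D I L A"
        using step.hyps(2) lift[OF _ v(1) h(1)] lift[OF _ h(1) v(1)] v(2) h(2) homotopic_imp_eq by blast
      with gv show "(g, h) \<in> homotopic_eq D I L A"
        using equiv_homotopic_eq[of L A] by (meson equivE transD)
    qed
  qed
  then show "(g, h) \<in> homotopic_eq D I L A"
    using gh h by (auto simp: homotopic_eq_def)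
qed

text \<open>The square gives [p, A] [g, A] = [f, A] [q, A]. Injectivity of the right-hand side
  passes to [g, A]; for surjectivity, solve on the right for the composite of \<open>h\<close> with
  \<open>p\<close>, then cancel \<open>p\<close> by injectivity of [p, A].\<close>

lemma class_two_out_of_three:
  assumes f: "f \<in> hom D X Y" and p: "p \<in> hom D X X'" and q: "q \<in> hom D Y Y'" and g: "g \<in> hom D X' Y'"
    and sq: "q \<cdot>\<^bsub>D\<^esub> f = g \<cdot>\<^bsub>D\<^esub> p"
    and fA: "class_surj A f" "class_inj A f" and pA: "class_inj A p"
    and qA: "class_surj A q" "class_inj A q"
  shows "class_surj A g" "class_inj A g"
proof -
  have sq': "(k \<cdot>\<^bsub>D\<^esub> g) \<cdot>\<^bsub>D\<^esub> p = (k \<cdot>\<^bsub>D\<^esub> q) \<cdot>\<^bsub>D\<^esub> f" if "k \<in> hom D Y' A" for k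
    using comp_assoc[OF p g that] comp_assoc[OF f q that] sq by simp
  show "class_surj A g"
    unfolding class_surj_def homD(2,3)[OF g]
  proof
    fix h assume h: "h \<in> hom D X' A"
    from class_surjE[OF fA(1) f comp_hom[OF p h]] obtain k where k: "k \<in> hom D Y A"
      "(k \<cdot>\<^bsub>D\<^esub> f, h \<cdot>\<^bsub>D\<^esub> p) \<in> homotopic_eq D I X A" by blast
    from class_surjE[OF qA(1) q k(1)] obtain l where l: "l \<in> hom D Y' A"
      "(l \<cdot>\<^bsub>D\<^esub> q, k) \<in> homotopic_eq D I Y A" by blast
    have "((l \<cdot>\<^bsub>D\<^esub> g) \<cdot>\<^bsub>D\<^esub> p, h \<cdot>\<^bsub>D\<^esub> p) \<in> homotopic_eq D I X A"
      unfolding sq'[OF l(1)]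
      using homotopic_eq_precomp[OF l(2) f] k(2) equiv_homotopic_eq[of X A] by (meson equivE transD)
    from class_injD[OF pA p comp_hom[OF g l(1)] h this] l(1)
    show "\<exists>k\<in>hom D Y' A. (k \<cdot>\<^bsub>D\<^esub> g, h) \<in> homotopic_eq D I X' A" by blast
  qed
  show "class_inj A g"
    unfolding class_inj_def homD(2,3)[OF g]
  proof (intro ballI impI)
    fix k l assume k: "k \<in> hom D Y' A" and l: "l \<in> hom D Y' A"
      and "(k \<cdot>\<^bsub>D\<^esub> g, l \<cdot>\<^bsub>D\<^esub> g) \<in> homotopic_eq D I X' A"
    from homotopic_eq_precomp[OF this(3) p]
    have "((k \<cdot>\<^bsub>D\<^esub> q) \<cdot>\<^bsub>D\<^esub> f, (l \<cdot>\<^bsub>D\<^esub> q) \<cdot>\<^bsub>D\<^esub> f) \<in> homotopic_eq D I X A"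
      by (simp add: sq' k l)
    from class_injD[OF fA(2) f comp_hom[OF q k] comp_hom[OF q l] this]
    show "(k, l) \<in> homotopic_eq D I Y' A"
      using class_injD[OF qA(2) q k l] by blast
  qed
qed

text \<open>Surjectivity at \<open>X\<close>, applied to the identity, yields \<open>g\<close> with
  \<open>g f\<close> equivalent to the identity. Then \<open>f g f\<close> is equivalent to
  \<open>f\<close>, and injectivity at \<open>Y\<close> cancels the \<open>f\<close> on the
  right.\<close>

lemma homotopy_equivalence_of_classes:
  assumes f: "f \<in> hom D X Y" and "class_surj X f" and "class_inj Y f"
  shows "homotopy_equivalence D I f"
proof -
  note objs = hom_Obj[OF f]
  obtain g where g: "g \<in> hom D Y X" "(g \<cdot>\<^bsub>D\<^esub> f, one D X) \<in> homotopic_eq D I X X"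
    using class_surjE[OF assms(2) f one_hom[OF objs(1)]] by blast
  have "((f \<cdot>\<^bsub>D\<^esub> g) \<cdot>\<^bsub>D\<^esub> f, one D Y \<cdot>\<^bsub>D\<^esub> f) \<in> homotopic_eq D I X Y"
    using homotopic_eq_postcomp[OF g(2) f] comp_assoc[OF f g(1) f] comp_one[OF f] one_comp[OF f] by simp
  from class_injD[OF assms(3) f comp_hom[OF g(1) f] one_hom[OF objs(2)] this]
  show ?thesis
    unfolding homotopy_equivalence_def homD(2,3)[OF f] using g homD(1)[OF f] by blast
qed

end

section \<open>Naively fibrant presheaves\<close>

context presheaves begin

text \<open>The lower side of the lifting square is the map from \<open>Y\<close> to the terminal
  object; the square commutes because maps into a terminal object are unique.\<close>

lemma extension_of_lifts:
  assumes A: "is_presheaf U C A" and f: "f \<in> hom (PSh U C) X Y"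
    and "lifts (PSh U C) f (to_terminal (PSh U C) A)" and u: "u \<in> hom (PSh U C) X A"
  shows "\<exists>v\<in>hom (PSh U C) Y A. v \<cdot>\<^bsub>PSh U C\<^esub> f = u"
proof -
  define E where "E = (SOME E. is_terminal (PSh U C) E)"
  have E: "is_terminal (PSh U C) E"
    unfolding E_def using terminal_exists by (rule someI_ex)
  then have uniq: "\<exists>!f. f \<in> hom (PSh U C) Z E" if "Z \<in> Obj (PSh U C)" for Z
    using that by (simp add: is_terminal_def)
  define t where "t = to_terminal (PSh U C) A"
  have t: "t \<in> hom (PSh U C) A E"
    unfolding t_def to_terminal_def E_def[symmetric] using theI'[OF uniq] A by simp
  obtain b where b: "b \<in> hom (PSh U C) Y E"
    using uniq[OF PSh.hom_Obj(2)[OF f]] by blast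
  have "t \<cdot>\<^bsub>PSh U C\<^esub> u = b \<cdot>\<^bsub>PSh U C\<^esub> f"
    using uniq[OF PSh.hom_Obj(1)[OF f]] PSh.comp_hom[OF u t] PSh.comp_hom[OF f b] by blast
  then show ?thesis
    using assms(3) u b unfolding t_def[symmetric] lifts_def homD(2,3)[OF f] homD(2,3)[OF t] by blast
qed

end

section \<open>Extension of maps and homotopies into naively fibrant presheaves\<close>

locale presheaf_cylinders = presheaves U C
  for U :: "'u set set" and C :: "('o, 'm) category" +
  fixes I :: "('o, 'm, 'u) presheaf_cylinder"
  assumes homotopy_data: "elementary_homotopy_data U (PSh U C) I"

sublocale presheaf_cylinders \<subseteq> cylinders "PSh U C" I
  by unfold_locales (use homotopy_data in \<open>simp add: elementary_homotopy_data_def\<close>)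

context presheaf_cylinders begin

text \<open>The subobject \<open>K \<otimes> I \<union> L \<otimes> \<partial>I\<close> is glued from \<open>K \<otimes> I\<close> and two copies of \<open>L\<close>: the copies of \<open>L\<close> are
  disjoint since \<open>[\<partial>\<^sup>0, \<partial>\<^sup>1]\<close> is monic, and each meets \<open>K \<otimes> I\<close> in \<open>K\<close> by the pullback axiom.\<close>

lemma extends_along_boundary:
  assumes j: "monic (PSh U C) j" and A: "is_presheaf U C A"
    and ext: "\<And>X Y i u. i = union_inclusion C I j (boundary_part U C I (mtgt j)) \<Longrightarrow>
      i \<in> hom (PSh U C) X Y \<Longrightarrow> u \<in> hom (PSh U C) X A \<Longrightarrow>
      \<exists>v\<in>hom (PSh U C) Y A. v \<cdot>\<^bsub>PSh U C\<^esub> i = u"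
  shows "extends_along (PSh U C) (tensor I) UNIV end_map A j"
proof -
  define K L KI LI where "K = msrc j" and "L = mtgt j" and "KI = fobj (tensor I) K" and "LI = fobj (tensor I) L"
  define jI where "jI = farr (tensor I) j"
  have jh: "j \<in> hom (PSh U C) K L"
    using j by (simp add: monic_def PSh_hom K_def L_def)
  have K: "K \<in> Obj (PSh U C)" and L: "L \<in> Obj (PSh U C)"
    using PSh.hom_Obj[OF jh] .
  have jIh: "jI \<in> hom (PSh U C) KI LI"
    unfolding jI_def KI_def LI_def by (rule functor_hom[OF tensor_functor jh])
  have jI: "monic (PSh U C) jI"
    using homotopy_data j by (simp add: elementary_homotopy_data_def preserves_monics_def jI_def)
  have pb: "is_pullback (PSh U C) j (end_map e K) (end_map e L) jI" for e
    using homotopy_data j by (simp add: elementary_homotopy_data_def jI_def K_def L_def)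
  note endK = end_hom[OF K, folded KI_def] and endL = end_hom[OF L, folded LI_def]
  note projL = proj_hom[OF L, folded LI_def]
  have LI: "is_presheaf U C LI"
    using PSh.hom_Obj(2)[OF endL] by simp
  have sel: "msrc j = K" "mtgt j = L" "msrc jI = KI" "mtgt jI = LI"
      "msrc (end_map e K) = K" "msrc (end_map e L) = L" "mtgt (end_map e L) = LI" for e
    using jIh endK endL by (simp_all add: PSh_hom K_def L_def)
  have monic_ends: "monic (PSh U C) (copair (PSh U C) (end_map False L) (end_map True L))"
    using cylinder[OF L] by (simp add: is_cylinder_def)
  \<comment> \<open>The projection of the cylinder is a retraction of each end map, which makes the
    end maps injective on sections.\<close>
  have end_inj: "x = y" if "c \<in> Obj C" "x \<in> sec L c" "y \<in> sec L c" "app (end_map e L) c x = app (end_map e L) c y"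
    for c e x y
    using that proj_end[OF L, of e] sel PSh_comp_app[of c C _ "end_map e L" U "proj (fobj I L)"] PSh_one_app
    by metis
  show ?thesis
  proof (rule extends_alongI[OF jh], fold LI_def KI_def jI_def)
    fix \<theta> g
    assume \<theta>: "\<theta> \<in> hom (PSh U C) KI A" and g': "\<And>e. e \<in> UNIV \<Longrightarrow> g e \<in> hom (PSh U C) L A"
      and eq': "\<And>e. e \<in> UNIV \<Longrightarrow> g e \<cdot>\<^bsub>PSh U C\<^esub> j = \<theta> \<cdot>\<^bsub>PSh U C\<^esub> end_map e K"
    note g = g'[OF UNIV_I] and eq = eq'[OF UNIV_I]
    have gsel: "msrc \<theta> = KI" "mtgt \<theta> = A" "msrc (g e) = L" "mtgt (g e) = A" for e
      using \<theta> g by (simp_all add: PSh_hom)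
    \<comment> \<open>The pieces are indexed by \<open>bool option\<close>: \<open>None\<close>
      stands for \<open>K \<otimes> I\<close>, and \<open>Some e\<close> for the copy of
      \<open>L\<close> at the end \<open>e\<close>.\<close>
    define s where "s k = (case k of None \<Rightarrow> jI | Some e \<Rightarrow> end_map e L)" for k
    define t where "t k = (case k of None \<Rightarrow> \<theta> | Some e \<Rightarrow> g e)" for k
    define X where "X k = (case k of None \<Rightarrow> KI | Some (e :: bool) \<Rightarrow> L)" for k
    define B where "B c = map_image jI c \<union> boundary_part U C I L c" for c
    have s: "s k \<in> hom (PSh U C) (X k) LI" and t: "t k \<in> hom (PSh U C) (X k) A" for k
      using jIh endL \<theta> g by (simp_all add: s_def t_def X_def split: option.split)
    \<comment> \<open>A section common to an end of \<open>L \<otimes> I\<close> and to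
      \<open>K \<otimes> I\<close> comes from \<open>K\<close> by the pullback axiom, and on
      \<open>K\<close> the prescribed ends agree with \<open>\<theta>\<close>.\<close>
    have cross: "app (g e) c x = app \<theta> c y"
      if c: "c \<in> Obj C" and x: "x \<in> sec L c" and y: "y \<in> sec KI c"
        and xy: "app (end_map e L) c x = app jI c y" for c x y e
    proof -
      obtain z where z: "z \<in> sec K c" "app j c z = x" "app (end_map e K) c z = y"
        using pullback_sections[OF pb c _ _ xy] x y sel by metis
      then show ?thesis
        using arg_cong[OF eq, of "\<lambda>f. app f c z" e] c sel by simp
    qed
    have disjoint: "app (end_map False L) c x \<noteq> app (end_map True L) c y"
      if "c \<in> Obj C" "x \<in> sec L c" "y \<in> sec L c" for c x y
      using copair_sections(2)[OF endL endL that(1) monic_ends that(2,3)] .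
    have compatible: "app (t i) c x = app (t k) c y"
      if c: "c \<in> Obj C" and x: "x \<in> sec (X i) c" and y: "y \<in> sec (X k) c"
        and xy: "app (s i) c x = app (s k) c y" for i k c x y
    proof (cases i)
      case None
      show ?thesis
      proof (cases k)
        assume "k = None"
        then show ?thesis
          using None x y xy monic_inj[OF jI c] by (auto simp: s_def t_def X_def sel)
      next
        fix e assume "k = Some e"
        then show ?thesis
          using None x y xy[symmetric] cross[OF c, symmetric] by (simp add: s_def t_def X_def)
      qed
    next
      case (Some e)
      show ?thesis
      proof (cases k)
        assume "k = None"
        then show ?thesis
          using Some x y xy cross[OF c] by (simp add: s_def t_def X_def)
      next
        fix e' assume k: "k = Some e'"
        have "e = e'"
          using Some k x y xy disjoint[OF c] by (cases e; cases e') (auto simp: s_def X_def dest: sym)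
        then show ?thesis
          using Some k x y xy end_inj[OF c] by (auto simp: s_def t_def X_def)
      qed
    qed
    have B: "B c = (\<Union>k. map_image (s k) c)" if "c \<in> Obj C" for c
      unfolding B_def boundary_part_def copair_sections(1)[OF endL endL that] UNIV_option_conv
      by (auto simp: s_def UNIV_bool)
    define i where "i = union_inclusion C I j (boundary_part U C I (mtgt j))"
    have i: "i = inclusion C LI B"
      by (simp add: i_def union_inclusion_def sel LI_def jI_def B_def[abs_def])
    obtain \<psi> where i_hom: "i \<in> hom (PSh U C) (subpresheaf C LI B) LI"
      and \<psi>: "\<psi> \<in> hom (PSh U C) (subpresheaf C LI B) A"
      and \<psi>_s: "\<And>k c x. c \<in> Obj C \<Longrightarrow> x \<in> sec (X k) c \<Longrightarrow> app \<psi> c (app (s k) c x) = app (t k) c x"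
      and mem: "\<And>k c x. c \<in> Obj C \<Longrightarrow> x \<in> sec (X k) c \<Longrightarrow> app (s k) c x \<in> B c"
      using glue[of s X LI t A B, OF s t LI A compatible B] unfolding i by blast
    obtain \<Theta> where \<Theta>: "\<Theta> \<in> hom (PSh U C) LI A" "\<Theta> \<cdot>\<^bsub>PSh U C\<^esub> i = \<psi>"
      using ext[OF i_def i_hom \<psi>] by blast
    \<comment> \<open>Since \<open>\<psi>\<close> was glued from the pieces, its extension
      \<open>\<Theta>\<close> restricts along each \<open>s k\<close> to \<open>t k\<close>. The
      index \<open>None\<close> gives the equation for \<open>\<theta>\<close>, and
      \<open>Some e\<close> the one for the end \<open>e\<close>.\<close>
    have \<Theta>_s: "\<Theta> \<cdot>\<^bsub>PSh U C\<^esub> s k = t k" for k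
    proof (rule presheaf_map_eqI[of U C])
      show "is_presheaf_map U C (\<Theta> \<cdot>\<^bsub>PSh U C\<^esub> s k)"
        using PSh.comp_hom[OF s \<Theta>(1)] by (simp add: PSh_hom)
      show "is_presheaf_map U C (t k)" "msrc (\<Theta> \<cdot>\<^bsub>PSh U C\<^esub> s k) = msrc (t k)"
        "mtgt (\<Theta> \<cdot>\<^bsub>PSh U C\<^esub> s k) = mtgt (t k)"
        using s[of k] t[of k] \<Theta>(1) by (simp_all add: PSh_hom)
      fix c x assume c: "c \<in> Obj C" and "x \<in> sec (msrc (\<Theta> \<cdot>\<^bsub>PSh U C\<^esub> s k)) c"
      then have x: "x \<in> sec (X k) c" "msrc (s k) = X k"
        using s[of k] by (simp_all add: PSh_hom)
      have "app \<psi> c (app (s k) c x) = app \<Theta> c (app (s k) c x)"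
        using mem[OF c x(1)] c unfolding \<Theta>(2)[symmetric] i by (simp add: inclusion_def subpresheaf_def)
      then show "app (\<Theta> \<cdot>\<^bsub>PSh U C\<^esub> s k) c x = app (t k) c x"
        using \<psi>_s[OF c x(1)] c x by simp
    qed
    show "\<exists>\<Theta>\<in>hom (PSh U C) LI A. \<Theta> \<cdot>\<^bsub>PSh U C\<^esub> jI = \<theta> \<and> (\<forall>e\<in>UNIV. \<Theta> \<cdot>\<^bsub>PSh U C\<^esub> end_map e L = g e)"
      using \<Theta>(1) \<Theta>_s[of None] \<Theta>_s[of "Some e" for e] by (auto simp: s_def t_def)
  qed
qed

text \<open>A generator has the left lifting property against everything that lifts against the
  generators, so it is anodyne. Being an arrow is asked separately: the members of a stage built by
  \<open>union_inclusion\<close> are given by a formula, and that they are maps of presheaves has to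
  be proved.\<close>

lemma generator_lifts:
  assumes "naively_fibrant U C I M S A" "f \<in> Lambda_stage U C I M S n" "f \<in> Arr (PSh U C)"
  shows "lifts (PSh U C) f (to_terminal (PSh U C) A)"
proof -
  have "f \<in> anodyne U C I M S"
    using assms(2,3) unfolding anodyne_def LLP_def RLP_def by blast
  then show ?thesis
    using assms(1) by (simp add: naively_fibrant_def RLP_def)
qed

lemma saturation_class_bij:
  assumes A: "naively_fibrant U C I M S A" and S: "S \<subseteq> monics (PSh U C)"
    and f: "f \<in> saturation U (PSh U C) S"
  shows "class_surj A f" "class_inj A f"
proof -
  have A': "is_presheaf U C A"
    using A by (simp add: naively_fibrant_def)
  have S_monic: "j \<in> Arr (PSh U C) \<and> monic (PSh U C) j" if "j \<in> S" for j
    using S that by (auto simp: monics_def monic_def)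
  define id_func where "id_func = (\<lparr>fobj = id, farr = id\<rparr> :: (('o, 'm, 'u) presheaf, ('o, 'm, 'u) presheaf_map, _, _) func)"
  \<comment> \<open>Plain extension prescribes no ends, so the index set is empty; the identities
    are a default value for the family \<open>d\<close>.\<close>
  interpret id: extension_problem U "PSh U C" id_func "{} :: unit set" "\<lambda>_. one (PSh U C)" A
  proof
    show "is_functor (PSh U C) (PSh U C) id_func"
      unfolding id_func_def by (rule functor_id) unfold_locales
    show "preserves_order_colimits U (PSh U C) id_func"
      unfolding id_func_def by (rule preserves_order_colimits_id)
  qed auto
  interpret htpy: extension_problem U "PSh U C" "tensor I" "UNIV :: bool set" end_map A
  proof
    show "is_functor (PSh U C) (PSh U C) (tensor I)"
      by (rule tensor_functor)
    show "preserves_order_colimits U (PSh U C) (tensor I)"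
      using homotopy_data by (intro preserves_order_colimits) (simp add: elementary_homotopy_data_def)
  qed (auto simp: end_hom end_natural)
  have "extends_along (PSh U C) id_func ({} :: unit set) (\<lambda>_. one (PSh U C)) A f"
  proof (rule id.saturation_extends_along[OF _ f])
    fix j assume "j \<in> S"
    then have j: "j \<in> Arr (PSh U C)" "j \<in> Lambda_stage U C I M S 0"
      using S_monic by auto
    show "extends_along (PSh U C) id_func ({} :: unit set) (\<lambda>_. one (PSh U C)) A j"
      using extension_of_lifts[OF A' Arr_hom[OF j(1)] generator_lifts[OF A j(2,1)]]
      by (intro extends_alongI[OF Arr_hom[OF j(1)]]) (auto simp: id_func_def)
  qed
  then have ext: "\<exists>v\<in>hom (PSh U C) (mtgt f) A. v \<cdot>\<^bsub>PSh U C\<^esub> f = u" if "u \<in> hom (PSh U C) (msrc f) A" for u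
    using that by (auto simp: extends_along_def id_func_def)
  have hep: "extends_along (PSh U C) (tensor I) UNIV end_map A f"
  proof (rule htpy.saturation_extends_along[OF _ f])
    fix j assume j: "j \<in> S"
    show "extends_along (PSh U C) (tensor I) UNIV end_map A j"
    proof (rule extends_along_boundary[OF _ A'])
      show "monic (PSh U C) j"
        using S_monic[OF j] by blast
      fix X Y i u
      assume i: "i = union_inclusion C I j (boundary_part U C I (mtgt j))"
        and hom: "i \<in> hom (PSh U C) X Y" and u: "u \<in> hom (PSh U C) X A"
      \<comment> \<open>Maps of \<open>S\<close> sit at stage \<open>0\<close>, so their boundary
        inclusions sit one stage later.\<close>
      have "i \<in> Lambda_stage U C I M S (Suc 0)"
        using j i by (auto simp: Lambda_def)
      from extension_of_lifts[OF A' hom generator_lifts[OF A this homD(1)[OF hom]] u]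
      show "\<exists>v\<in>hom (PSh U C) Y A. v \<cdot>\<^bsub>PSh U C\<^esub> i = u" .
    qed
  qed
  then have fh: "f \<in> hom (PSh U C) (msrc f) (mtgt f)"
    by (simp add: extends_along_def PSh_hom)
  show "class_surj A f"
    by (rule class_surj_extension[OF fh ext])
  show "class_inj A f"
    by (rule class_inj_extension[OF fh ext hep])
qed

end

section \<open>Comparison of a weak equivalence with its image under the monad\<close>

theorem proposition2p8:
  fixes U :: "'u set set"
    and C :: "('o, 'm) category"
    and I :: "('o, 'm, 'u) presheaf_cylinder"
    and M :: "('o, 'm, 'u) presheaf_map set"
    and T :: "(('o, 'm, 'u) presheaf, ('o, 'm, 'u) presheaf_map,
               ('o, 'm, 'u) presheaf, ('o, 'm, 'u) presheaf_map) func"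
    and \<eta> \<mu> :: "('o, 'm, 'u) presheaf \<Rightarrow> ('o, 'm, 'u) presheaf_map"
    and J :: "'j set"
    and G :: "'j \<Rightarrow> ('o, 'm, 'u) presheaf"
    and \<GG> :: "('o, 'm, 'u) presheaf_map set"
    and \<W>' :: "('o, 'm, 'u) presheaf_map set"
  assumes universe: "set_universe U"
    and C: "category C" "small U (Obj C)" "small U (Arr C)"
    and I: "elementary_homotopy_data U (PSh U C) I"
    and M: "small U M" "M \<subseteq> monics (PSh U C)" "saturation U (PSh U C) M = monics (PSh U C)"
    and T: "monad (PSh U C) T \<eta> \<mu>"
    and M1: "preserves_monics (PSh U C) T" "\<forall>X\<in>Obj (PSh U C). monic (PSh U C) (\<eta> X)"
    and \<GG>: "small U J" "\<forall>j\<in>J. G j \<in> Obj (PSh U C)" "\<GG> = {\<eta> (G j) | j. j \<in> J}"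
    and M2: "\<forall>X\<in>Obj (PSh U C). \<eta> X \<in> saturation U (PSh U C) \<GG>"
    and M3: "\<forall>A a. is_algebra (PSh U C) T \<eta> \<mu> A a \<longrightarrow>
               to_terminal (PSh U C) A \<in> RLP (PSh U C) (anodyne U C I M \<GG>)"
    and W': "\<W>' \<subseteq> Arr (PSh U C)"
    and W'_three_for_two: "three_for_two (PSh U C) \<W>'"
    and W'_homotopy_equivalences: "\<forall>f. homotopy_equivalence (PSh U C) I f \<longrightarrow> f \<in> \<W>'"
    and W'_units: "\<forall>X\<in>Obj (PSh U C). \<eta> X \<in> \<W>'"
  shows "weak_equivalences (generated_model_structure U C I M \<GG>) \<subseteq> \<W>'"
proof
  interpret presheaf_cylinders U C I
    using universe C(1) I
    by (simp add: presheaf_cylinders_def presheaves_def presheaf_cylinders_axioms_def)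
  interpret T: monad "PSh U C" T \<eta> \<mu>
    by fact
  have monics: "\<GG> \<subseteq> monics (PSh U C)"
    using \<GG> M1(2) by (auto simp: monics_def)
  have fibrant: "naively_fibrant U C I M \<GG> (fobj T X)" if X: "X \<in> Obj (PSh U C)" for X
  proof -
    have TX: "fobj T X \<in> Obj (PSh U C)"
      using PSh.hom_Obj(2)[OF T.unit_hom[OF X]] .
    \<comment> \<open>The free algebra on \<open>X\<close>: its structure map is
      \<open>\<mu> X\<close>, and the algebra axioms are a unit law and associativity of the
      monad.\<close>
    have "is_algebra (PSh U C) T \<eta> \<mu> (fobj T X) (\<mu> X)"
      unfolding is_algebra_def
      using TX T.mult_hom[OF X] T.unit_left[OF X] T.mult_assoc[OF X] by simp
    then show ?thesis
      using M3 TX unfolding naively_fibrant_def by blast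
  qed
  \<comment> \<open>Both directions are used below: forwards to compose the unit at \<open>X\<close>
    with \<open>farr T f\<close>, backwards to cancel the unit at \<open>Y\<close> after
    \<open>f\<close>.\<close>
  have three: "f \<in> \<W>' \<longleftrightarrow> g \<cdot>\<^bsub>PSh U C\<^esub> f \<in> \<W>'"
    if "g \<in> \<W>'" "f \<in> hom (PSh U C) X Y" "g \<in> hom (PSh U C) Y Z" for f g X Y Z
    using W'_three_for_two that unfolding three_for_two_def by (metis homD)
  fix f assume "f \<in> weak_equivalences (generated_model_structure U C I M \<GG>)"
  then have f_Arr: "f \<in> Arr (PSh U C)" and bij: "\<And>A. naively_fibrant U C I M \<GG> A \<Longrightarrow>
      bij_betw (precomp_class (PSh U C) I f A)
        (homotopy_classes (PSh U C) I (mtgt f) A) (homotopy_classes (PSh U C) I (msrc f) A)"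
    by (auto simp: generated_model_structure_def gen_weak_equivalences_def)
  define X Y where "X = msrc f" and "Y = mtgt f"
  have f: "f \<in> hom (PSh U C) X Y"
    using Arr_hom[OF f_Arr] by (simp add: X_def Y_def)
  have X: "X \<in> Obj (PSh U C)" and Y: "Y \<in> Obj (PSh U C)"
    using PSh.hom_Obj[OF f] .
  note \<eta>X = T.unit_hom[OF X] and \<eta>Y = T.unit_hom[OF Y]
  have Tf: "farr T f \<in> hom (PSh U C) (fobj T X) (fobj T Y)"
    by (rule functor_hom[OF T.endofunctor f])
  have Tf_classes: "class_surj A (farr T f)" "class_inj A (farr T f)"
    if A: "naively_fibrant U C I M \<GG> A" for A
  proof -
    note f_classes = precomp_class_bij[OF f bij[OF A, folded X_def Y_def]]
    have \<eta>_classes: "class_surj A (\<eta> Z)" "class_inj A (\<eta> Z)" if "Z \<in> Obj (PSh U C)" for Z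
      using saturation_class_bij[OF A monics] M2 that by blast+
    show "class_surj A (farr T f)" "class_inj A (farr T f)"
      using class_two_out_of_three[OF f \<eta>X \<eta>Y Tf T.unit_natural[OF f] f_classes
          \<eta>_classes(2)[OF X] \<eta>_classes[OF Y]] .
  qed
  have "homotopy_equivalence (PSh U C) I (farr T f)"
    by (rule homotopy_equivalence_of_classes[OF Tf])
      (use Tf_classes fibrant X Y in blast)+
  then have "farr T f \<in> \<W>'"
    using W'_homotopy_equivalences by blast
  then have "farr T f \<cdot>\<^bsub>PSh U C\<^esub> \<eta> X \<in> \<W>'"
    using three[OF _ \<eta>X Tf] W'_units X by blast
  then have "\<eta> Y \<cdot>\<^bsub>PSh U C\<^esub> f \<in> \<W>'"
    using T.unit_natural[OF f] by simp
  then show "f \<in> \<W>'"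
    using three[OF _ f \<eta>Y] W'_units Y by blast
qed

end
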